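(* Let $\|\cdot\|$ be an admissible norm on $\mathbb{R}^3$, and let $f:M\rightarrow(\mathbb{R}^3,\|\cdot\|)$ be an immersion of a compact, connected surface $M$ without boundary, endowed with a Birkhoff normal vector field $\eta:M\to\partial B$ and principal curvature functions $\lambda_1\geq\lambda_2$. Assume that $M$ has coercively convex curvature lines at any point where the greatest principal curvature function $\lambda_1$ attains a global maximum. If the Minkowski Gaussian curvature $K=\lambda_1\lambda_2$ is positive and the Minkowski mean curvature $H=\frac{\lambda_1+\lambda_2}{2}$ is constant, then $M$ (identified with $f(M)$) is a Minkowski sphere.
   Context: Let $B$ and $\partial B$ be the unit ball and unit sphere of $\|\cdot\|$. The norm is smooth if $\partial B$ is locally the graph of a $C^\infty$ function, and strictly convex if $\partial B$ contains no line segment. It is admissible if it is smooth, strictly convex, and $\partial B$ has positive Euclidean Gaussian curvature at every point. A Minkowski sphere of radius $\rho>0$ is a set $\{x:\|x-c\|=\rho\}$. A non-zero vector $v$ is Birkhoff orthogonal to a 2-dimensional subspace $H$ ($v\dashv_B H$) if the plane through $v/\|v\|$ parallel to $H$ supports $B$. For a smooth immersion $f:M\to\mathbb{R}^3$ of a surface, $M$ is identified with its image and $T_pM$ with the plane $df_p(T_pM)\subset\mathbb{R}^3$. A Birkhoff normal vector field (Birkhoff-Gauss map) is a smooth map $\eta$ into $\partial B$ with $\eta(p)\dashv_B T_pM$; it is unique up to sign, exists locally, and exists globally iff $M$ is orientable. Since $T_{\eta(p)}\partial B$ and $T_pM$ are the same plane, $d\eta_p$ is a linear endomorphism of $T_pM$;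 it is diagonalizable over $\mathbb{R}$. Its eigenvalues $\lambda_1(p)\ge\lambda_2(p)$ are the principal curvatures, its eigenvectors the principal directions. A point is umbilic if $\lambda_1(p)=\lambda_2(p)$. Coercive convexity: let $D$ be the standard flat connection of $\mathbb{R}^3$. Near a non-umbilic point $p$ choose non-vanishing vector fields $V_1,V_2$ on $M$ that are principal directions for $\lambda_1,\lambda_2$ respectively, scaled so that $[V_1,V_2]=0$. Then $D_{V_1}V_2$ is tangent to $M$, and one writes $D_{V_1}V_2=f_1V_1+g_1V_2$ with smooth functions $f_1,g_1$. $M$ has coercively convex curvature lines at $p$ if the following holds: whenever $D_{V_1}V_2|_p=0$, the component $f_1$ of $D_{V_1}V_2$ along $V_1$, restricted to the trajectory $\gamma$ of $V_2$ through $p$, has negative derivative at $p$, i.e. $V_2(f_1)(p)<0$. At umbilic points the condition is regarded as vacuous. *)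

theory Defs
  imports "HOL-Analysis.Analysis"
begin

section \<open>Smooth maps between Euclidean spaces\<close>

text \<open>\<^term>\<open>dder f u v\<close> is the derivative of \<^term>\<open>f\<close> at \<^term>\<open>u\<close> in the direction \<^term>\<open>v\<close>. It is only
  used where \<^term>\<open>f\<close> is differentiable at \<^term>\<open>u\<close>.\<close>

definition dder :: "('a::real_normed_vector \<Rightarrow> 'b::real_normed_vector) \<Rightarrow> 'a \<Rightarrow> 'a \<Rightarrow> 'b" where
  "dder f u v = frechet_derivative f (at u) v"

text \<open>For open \<^term>\<open>S\<close> in a finite-dimensional space, \<^term>\<open>diff_times S f k\<close> says that \<^term>\<open>f\<close> is
  of class \<open>C\<^sup>k\<close> on \<^term>\<open>S\<close>.\<close>

fun diff_times :: "'a::real_normed_vector set \<Rightarrow> ('a \<Rightarrow> 'b::real_normed_vector) \<Rightarrow> nat \<Rightarrow> bool" where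
  "diff_times S f 0 \<longleftrightarrow> continuous_on S f"
| "diff_times S f (Suc k) \<longleftrightarrow>
     (\<forall>x\<in>S. f differentiable at x) \<and> (\<forall>v. diff_times S (\<lambda>x. dder f x v) k)"

definition smooth_on :: "'a::real_normed_vector set \<Rightarrow> ('a \<Rightarrow> 'b::real_normed_vector) \<Rightarrow> bool" where
  "smooth_on S f \<longleftrightarrow> (\<forall>k. diff_times S f k)"


section \<open>Admissible norms on three-space\<close>

definition is_norm :: "(real^3 \<Rightarrow> real) \<Rightarrow> bool" where
  "is_norm N \<longleftrightarrow>
     (\<forall>x. 0 \<le> N x) \<and> (\<forall>x. N x = 0 \<longleftrightarrow> x = 0) \<and>
     (\<forall>a x. N (a *\<^sub>R x) = \<bar>a\<bar> * N x) \<and> (\<forall>x y. N (x + y) \<le> N x + N y)"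

definition unit_ball :: "(real^3 \<Rightarrow> real) \<Rightarrow> (real^3) set" where
  "unit_ball N = {x. N x \<le> 1}"

definition unit_sphere :: "(real^3 \<Rightarrow> real) \<Rightarrow> (real^3) set" where
  "unit_sphere N = {x. N x = 1}"

definition minkowski_sphere :: "(real^3 \<Rightarrow> real) \<Rightarrow> (real^3) set \<Rightarrow> bool" where
  "minkowski_sphere N S \<longleftrightarrow> (\<exists>c \<rho>. \<rho> > 0 \<and> S = {x. N (x - c) = \<rho>})"

text \<open>\<open>X\<close> parametrizes a relatively open piece of \<open>S\<close> as the graph of a \<open>C\<^sup>\<infinity>\<close> function
  \<open>g\<close> over an open set \<open>V\<close>, in Euclidean coordinates given by a linear isometry \<open>A\<close> (the product
  type carries the Euclidean norm).\<close>

definition graph_patch :: "(real^3) set \<Rightarrow> (real^2) set \<Rightarrow> (real^2 \<Rightarrow> real^3) \<Rightarrow> bool" where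
  "graph_patch S V X \<longleftrightarrow> open V \<and>
     (\<exists>(A :: (real^2) \<times> real \<Rightarrow> real^3) g W.
        linear A \<and> (\<forall>z. norm (A z) = norm z) \<and> smooth_on V g \<and>
        X = (\<lambda>u. A (u, g u)) \<and> open W \<and> S \<inter> W = X ` V)"

definition locally_smooth_graph :: "(real^3) set \<Rightarrow> bool" where
  "locally_smooth_graph S \<longleftrightarrow> (\<forall>p\<in>S. \<exists>V X. graph_patch S V X \<and> p \<in> X ` V)"

definition no_segment :: "(real^3) set \<Rightarrow> bool" where
  "no_segment S \<longleftrightarrow> (\<forall>a b. a \<noteq> b \<longrightarrow> \<not> closed_segment a b \<subseteq> S)"

text \<open>The classical formula \<open>(LN - M\<^sup>2) / (EG - F\<^sup>2)\<close> in terms of the coefficients of the first and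
  second fundamental forms.\<close>

definition euclidean_gauss_curvature :: "(real^2 \<Rightarrow> real^3) \<Rightarrow> real^2 \<Rightarrow> real" where
  "euclidean_gauss_curvature X u =
    (let e1 = axis 1 1; e2 = axis 2 1;
         X1 = dder X u e1; X2 = dder X u e2;
         X11 = dder (\<lambda>x. dder X x e1) u e1;
         X12 = dder (\<lambda>x. dder X x e1) u e2;
         X22 = dder (\<lambda>x. dder X x e2) u e2;
         n = cross3 X1 X2 /\<^sub>R norm (cross3 X1 X2)
     in ((X11 \<bullet> n) * (X22 \<bullet> n) - (X12 \<bullet> n)\<^sup>2) / ((X1 \<bullet> X1) * (X2 \<bullet> X2) - (X1 \<bullet> X2)\<^sup>2))"

definition positively_curved :: "(real^3) set \<Rightarrow> bool" where
  "positively_curved S \<longleftrightarrow>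
     (\<forall>V X. graph_patch S V X \<longrightarrow> (\<forall>u\<in>V. euclidean_gauss_curvature X u > 0))"

definition admissible_norm :: "(real^3 \<Rightarrow> real) \<Rightarrow> bool" where
  "admissible_norm N \<longleftrightarrow> is_norm N \<and> locally_smooth_graph (unit_sphere N) \<and>
     no_segment (unit_sphere N) \<and> positively_curved (unit_sphere N)"


section \<open>Birkhoff orthogonality\<close>

definition supports :: "(real^3) set \<Rightarrow> (real^3) set \<Rightarrow> bool" where
  "supports P C \<longleftrightarrow>
     (\<exists>n c. n \<noteq> 0 \<and> P = {x. n \<bullet> x = c} \<and> P \<inter> C \<noteq> {} \<and> (\<forall>x\<in>C. n \<bullet> x \<le> c))"

definition birkhoff_orthogonal :: "(real^3 \<Rightarrow> real) \<Rightarrow> real^3 \<Rightarrow> (real^3) set \<Rightarrow> bool" where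
  "birkhoff_orthogonal N v H \<longleftrightarrow> v \<noteq> 0 \<and> subspace H \<and> dim H = 2 \<and>
     supports ((\<lambda>h. v /\<^sub>R N v + h) ` H) (unit_ball N)"


section \<open>Surfaces and immersions\<close>

text \<open>A surface without boundary is a topological space \<open>M\<close> with a \<open>C\<^sup>\<infinity>\<close> atlas \<open>\<A>\<close>. The elements
  of the atlas are the inverses of charts: pairs \<open>(V, X)\<close> of an open subset \<open>V\<close> of the plane and a
  homeomorphism \<open>X\<close> of \<open>V\<close> onto an open subset of \<open>M\<close>.\<close>

type_synonym 'm atlas = "((real^2) set \<times> (real^2 \<Rightarrow> 'm)) set"

definition smooth_surface :: "'m topology \<Rightarrow> 'm atlas \<Rightarrow> bool" where
  "smooth_surface M \<A> \<longleftrightarrow> Hausdorff_space M \<and> second_countable M \<and>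
     (\<forall>(V, X)\<in>\<A>. open V \<and> openin M (X ` V) \<and>
        homeomorphic_map (top_of_set V) (subtopology M (X ` V)) X) \<and>
     topspace M = (\<Union>(V, X)\<in>\<A>. X ` V) \<and>
     (\<forall>(V, X)\<in>\<A>. \<forall>(V', X')\<in>\<A>.
        smooth_on {u\<in>V. X u \<in> X' ` V'} (\<lambda>u. inv_into V' X' (X u)))"

definition smooth_map :: "'m atlas \<Rightarrow> ('m \<Rightarrow> real^3) \<Rightarrow> bool" where
  "smooth_map \<A> h \<longleftrightarrow> (\<forall>(V, X)\<in>\<A>. smooth_on V (h \<circ> X))"

definition smooth_immersion :: "'m atlas \<Rightarrow> ('m \<Rightarrow> real^3) \<Rightarrow> bool" where
  "smooth_immersion \<A> f \<longleftrightarrow>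
     smooth_map \<A> f \<and> (\<forall>(V, X)\<in>\<A>. \<forall>u\<in>V. inj (dder (f \<circ> X) u))"

text \<open>The plane \<open>df\<^sub>p(T\<^sub>pM)\<close> for \<open>p = X u\<close>.\<close>

definition tangent_plane :: "('m \<Rightarrow> real^3) \<Rightarrow> (real^2 \<Rightarrow> 'm) \<Rightarrow> real^2 \<Rightarrow> (real^3) set" where
  "tangent_plane f X u = range (dder (f \<circ> X) u)"

definition birkhoff_normal_field ::
  "(real^3 \<Rightarrow> real) \<Rightarrow> 'm atlas \<Rightarrow> ('m \<Rightarrow> real^3) \<Rightarrow> ('m \<Rightarrow> real^3) \<Rightarrow> bool" where
  "birkhoff_normal_field N \<A> f \<eta> \<longleftrightarrow> smooth_map \<A> \<eta> \<and>
     (\<forall>(V, X)\<in>\<A>. \<forall>u\<in>V. \<eta> (X u) \<in> unit_sphere N \<and>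
        birkhoff_orthogonal N (\<eta> (X u)) (tangent_plane f X u))"


section \<open>Principal curvatures\<close>

text \<open>The endomorphism \<open>d\<eta>\<^sub>p\<close> of the plane \<open>df\<^sub>p(T\<^sub>pM)\<close>, \<open>p = X u\<close>, sends \<open>d(f \<circ> X)\<^sub>u(w)\<close> to
  \<open>d(\<eta> \<circ> X)\<^sub>u(w)\<close>. Hence the tangent vector with coordinates \<open>w\<close> is an eigenvector of it, with
  eigenvalue \<open>l\<close>, iff the following holds.\<close>

definition principal_vector ::
  "('m \<Rightarrow> real^3) \<Rightarrow> ('m \<Rightarrow> real^3) \<Rightarrow> (real^2 \<Rightarrow> 'm) \<Rightarrow> real^2 \<Rightarrow> real \<Rightarrow> real^2 \<Rightarrow> bool" where
  "principal_vector f \<eta> X u l w \<longleftrightarrow>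
     w \<noteq> 0 \<and> dder (\<eta> \<circ> X) u w = l *\<^sub>R dder (f \<circ> X) u w"

definition principal_values ::
  "'m atlas \<Rightarrow> ('m \<Rightarrow> real^3) \<Rightarrow> ('m \<Rightarrow> real^3) \<Rightarrow> 'm \<Rightarrow> real set" where
  "principal_values \<A> f \<eta> p =
     {l. \<exists>(V, X)\<in>\<A>. \<exists>u\<in>V. X u = p \<and> (\<exists>w. principal_vector f \<eta> X u l w)}"

text \<open>Since \<open>d\<eta>\<^sub>p\<close> is diagonalizable over the reals, it has one or two eigenvalues, and their
  maximum and minimum are the eigenvalues counted with multiplicity.\<close>

definition lambda1 :: "'m atlas \<Rightarrow> ('m \<Rightarrow> real^3) \<Rightarrow> ('m \<Rightarrow> real^3) \<Rightarrow> 'm \<Rightarrow> real" where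
  "lambda1 \<A> f \<eta> p = Max (principal_values \<A> f \<eta> p)"

definition lambda2 :: "'m atlas \<Rightarrow> ('m \<Rightarrow> real^3) \<Rightarrow> ('m \<Rightarrow> real^3) \<Rightarrow> 'm \<Rightarrow> real" where
  "lambda2 \<A> f \<eta> p = Min (principal_values \<A> f \<eta> p)"

definition minkowski_gauss_curvature ::
  "'m atlas \<Rightarrow> ('m \<Rightarrow> real^3) \<Rightarrow> ('m \<Rightarrow> real^3) \<Rightarrow> 'm \<Rightarrow> real" where
  "minkowski_gauss_curvature \<A> f \<eta> p = lambda1 \<A> f \<eta> p * lambda2 \<A> f \<eta> p"

definition minkowski_mean_curvature ::
  "'m atlas \<Rightarrow> ('m \<Rightarrow> real^3) \<Rightarrow> ('m \<Rightarrow> real^3) \<Rightarrow> 'm \<Rightarrow> real" where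
  "minkowski_mean_curvature \<A> f \<eta> p = (lambda1 \<A> f \<eta> p + lambda2 \<A> f \<eta> p) / 2"

definition umbilic :: "'m atlas \<Rightarrow> ('m \<Rightarrow> real^3) \<Rightarrow> ('m \<Rightarrow> real^3) \<Rightarrow> 'm \<Rightarrow> bool" where
  "umbilic \<A> f \<eta> p \<longleftrightarrow> lambda1 \<A> f \<eta> p = lambda2 \<A> f \<eta> p"


section \<open>Coercively convex curvature lines\<close>

text \<open>Vector fields on \<open>X ` W\<close> are given by their coordinates \<open>w :: real^2 \<Rightarrow> real^2\<close> with respect
  to \<open>X\<close>; as vectors of three-space they are \<open>push f X w\<close>.\<close>

definition push :: "('m \<Rightarrow> real^3) \<Rightarrow> (real^2 \<Rightarrow> 'm) \<Rightarrow> (real^2 \<Rightarrow> real^2) \<Rightarrow> real^2 \<Rightarrow> real^3" where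
  "push f X w u = dder (f \<circ> X) u (w u)"

definition lie_bracket :: "(real^2 \<Rightarrow> real^2) \<Rightarrow> (real^2 \<Rightarrow> real^2) \<Rightarrow> real^2 \<Rightarrow> real^2" where
  "lie_bracket v w u = dder w u (v u) - dder v u (w u)"

text \<open>The flat derivative \<open>D\<^sub>V W\<close> for vector fields with coordinates \<open>v\<close> and \<open>w\<close>.\<close>

definition flat_deriv ::
  "('m \<Rightarrow> real^3) \<Rightarrow> (real^2 \<Rightarrow> 'm) \<Rightarrow> (real^2 \<Rightarrow> real^2) \<Rightarrow> (real^2 \<Rightarrow> real^2) \<Rightarrow> real^2 \<Rightarrow> real^3" where
  "flat_deriv f X v w u = dder (push f X w) u (v u)"

definition commuting_principal_fields ::
  "'m atlas \<Rightarrow> ('m \<Rightarrow> real^3) \<Rightarrow> ('m \<Rightarrow> real^3) \<Rightarrow> (real^2 \<Rightarrow> 'm) \<Rightarrow> (real^2) set \<Rightarrow>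
     (real^2 \<Rightarrow> real^2) \<Rightarrow> (real^2 \<Rightarrow> real^2) \<Rightarrow> bool" where
  "commuting_principal_fields \<A> f \<eta> X W w1 w2 \<longleftrightarrow> smooth_on W w1 \<and> smooth_on W w2 \<and>
     (\<forall>u\<in>W. principal_vector f \<eta> X u (lambda1 \<A> f \<eta> (X u)) (w1 u) \<and>
            principal_vector f \<eta> X u (lambda2 \<A> f \<eta> (X u)) (w2 u) \<and>
            lie_bracket w1 w2 u = 0)"

text \<open>Such fields \<open>w1\<close>, \<open>w2\<close> exist near every non-umbilic point. They are unique up to non-vanishing
  factors that are constant along the trajectories of the other field, and the condition below is
  invariant under such a rescaling: a factor \<open>b\<close> on \<open>w2\<close> multiplies the derivative of \<open>f1\<close> along
  \<open>w2\<close> by \<open>b\<^sup>2\<close> wherever \<open>f1\<close> vanishes, and a factor on \<open>w1\<close> does not change it. So it does not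
  matter which fields are chosen. The components \<open>f1\<close>, \<open>g1\<close> are unique because all points of
  \<open>X ` W\<close> are non-umbilic.\<close>

definition coercively_convex_at ::
  "'m atlas \<Rightarrow> ('m \<Rightarrow> real^3) \<Rightarrow> ('m \<Rightarrow> real^3) \<Rightarrow> 'm \<Rightarrow> bool" where
  "coercively_convex_at \<A> f \<eta> p \<longleftrightarrow>
     (\<not> umbilic \<A> f \<eta> p \<longrightarrow>
       (\<exists>(V, X)\<in>\<A>. \<exists>W u w1 w2.
          open W \<and> W \<subseteq> V \<and> u \<in> W \<and> X u = p \<and> (\<forall>x\<in>W. \<not> umbilic \<A> f \<eta> (X x)) \<and>
          commuting_principal_fields \<A> f \<eta> X W w1 w2 \<and>
          (\<forall>f1 g1. smooth_on W f1 \<and> smooth_on W g1 \<and>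
             (\<forall>x\<in>W. flat_deriv f X w1 w2 x = f1 x *\<^sub>R push f X w1 x + g1 x *\<^sub>R push f X w2 x) \<longrightarrow>
             flat_deriv f X w1 w2 u = 0 \<longrightarrow> dder f1 u (w2 u) < (0::real))))"

end

theory Submission
  imports Defs
begin

text \<open>At a maximum \<open>p\<close> of \<open>\<lambda>\<^sub>1\<close> the other curvature \<open>\<lambda>\<^sub>2 = 2 h - \<lambda>\<^sub>1\<close> has a minimum, so both are
  critical at \<open>p\<close>. If \<open>p\<close> is not umbilic, take commuting principal fields \<open>V\<^sub>1\<close>, \<open>V\<^sub>2\<close> near \<open>p\<close>, so
  that \<open>D\<^sub>V\<^sub>i\<eta> = \<lambda>\<^sub>i V\<^sub>i\<close>. Second derivatives along commuting fields commute, which gives the Codazzi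
  equation \<open>(\<lambda>\<^sub>1 - \<lambda>\<^sub>2) D\<^sub>V\<^sub>1V\<^sub>2 = V\<^sub>1(\<lambda>\<^sub>2) V\<^sub>2 - V\<^sub>2(\<lambda>\<^sub>1) V\<^sub>1\<close> (\<open>codazzi_commuting_fields\<close>). Hence
  \<open>f\<^sub>1 = - V\<^sub>2(\<lambda>\<^sub>1) / (\<lambda>\<^sub>1 - \<lambda>\<^sub>2)\<close>, and at \<open>p\<close> the vector \<open>D\<^sub>V\<^sub>1V\<^sub>2\<close> vanishes while
  \<open>V\<^sub>2(f\<^sub>1) = - V\<^sub>2(V\<^sub>2(\<lambda>\<^sub>1)) / (\<lambda>\<^sub>1 - \<lambda>\<^sub>2) \<ge> 0\<close> because \<open>\<lambda>\<^sub>1\<close> is maximal. Coercive convexity forbids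
  this, so \<open>p\<close> is umbilic (\<open>max_lambda1_umbilic\<close>).

  Then \<open>\<lambda>\<^sub>1 \<le> \<lambda>\<^sub>1(p) = h\<close> everywhere, and \<open>\<lambda>\<^sub>1 \<ge> h\<close> since \<open>h\<close> is the mean of the two curvatures. So
  every point is umbilic, \<open>d\<eta> = h df\<close>, and \<open>h \<noteq> 0\<close> as \<open>K = h\<^sup>2 > 0\<close>. Therefore \<open>\<eta> - h f\<close> is constant,
  and \<open>f\<close> maps \<open>M\<close> into a Minkowski sphere of radius \<open>1 / \<bar>h\<bar>\<close>. It fills that sphere because \<open>\<eta>\<close> is
  onto the unit sphere: given a support plane of the ball at \<open>z\<close> with conormal \<open>n\<close>, the function
  \<open>n \<bullet> \<eta>\<close> has a maximum on \<open>M\<close>, where the tangent plane is parallel to the support plane, and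
  strict convexity identifies \<open>\<eta>\<close> there with \<open>z\<close> (\<open>normal_surjective\<close>).

  The existence and continuity of \<open>\<lambda>\<^sub>1\<close> rest on the diagonalizability of \<open>d\<eta>\<close>
  (\<open>shape_operator_symmetrizable\<close>): if \<open>b\<close> and \<open>c\<close> are the second fundamental forms of the surface at
  \<open>p\<close> and of the unit sphere at \<open>\<eta>(p)\<close>, taken with the same normal, then \<open>b(v, w) = c(d\<eta> v, w)\<close>. As \<open>b\<close> is
  symmetric and \<open>c\<close> is definite, \<open>d\<eta>\<close> is self-adjoint for an inner product.\<close>

section \<open>Calculus of smooth maps\<close>

lemma has_derivative_dder: "f differentiable at x \<Longrightarrow> (f has_derivative dder f x) (at x)"
  unfolding dder_def by (simp add: frechet_derivative_works[symmetric])

lemma dder_eqI: "(f has_derivative f') (at x) \<Longrightarrow> dder f x v = f' v"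
  unfolding dder_def by (simp add: frechet_derivative_at[symmetric])

lemma has_derivative_cong_open:
  assumes "open S" "x \<in> S" "\<And>y. y \<in> S \<Longrightarrow> f y = g y" "(f has_derivative f') (at x)"
  shows "(g has_derivative f') (at x)"
  using has_derivative_transform_within_open[OF assms(4,1,2)] assms(3) by auto

lemma dder_cong_open:
  assumes "open S" "x \<in> S" "\<And>y. y \<in> S \<Longrightarrow> f y = g y"
  shows "dder f x v = dder g x v"
proof -
  have "(f has_derivative D) (at x) \<longleftrightarrow> (g has_derivative D) (at x)" for D
    using has_derivative_cong_open[OF assms(1,2)] assms(3) by metis
  then show ?thesis
    by (simp add: dder_def frechet_derivative_def)
qed

lemma diff_times_cong:
  assumes "open S" "\<And>y. y \<in> S \<Longrightarrow> f y = g y"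
  shows "diff_times S f k = diff_times S g k"
  using assms(2)
proof (induction k arbitrary: f g)
  case 0
  then show ?case by (auto cong: continuous_on_cong)
next
  case (Suc k)
  have "f differentiable at x \<longleftrightarrow> g differentiable at x" if "x \<in> S" for x
    using has_derivative_cong_open[OF assms(1) that] Suc.prems
    unfolding differentiable_def by metis
  moreover have "diff_times S (\<lambda>x. dder f x v) k = diff_times S (\<lambda>x. dder g x v) k" for v
    using dder_cong_open[OF assms(1)] Suc.prems by (intro Suc.IH) auto
  ultimately show ?case by simp
qed

lemma smooth_on_cong:
  assumes "smooth_on S f" "open S" "\<And>y. y \<in> S \<Longrightarrow> f y = g y"
  shows "smooth_on S g"
  using assms diff_times_cong unfolding smooth_on_def by metis

lemma diff_times_SucD: "diff_times S f (Suc k) \<Longrightarrow> diff_times S f k"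
proof (induction k arbitrary: f)
  case 0
  then show ?case
    by (auto intro!: continuous_at_imp_continuous_on differentiable_imp_continuous_within)
next
  case (Suc k)
  then show ?case by (metis diff_times.simps(2))
qed

lemma smooth_on_differentiable: "smooth_on S f \<Longrightarrow> x \<in> S \<Longrightarrow> f differentiable at x"
  unfolding smooth_on_def using diff_times.simps(2) by blast

lemma smooth_on_has_derivative:
  "smooth_on S f \<Longrightarrow> x \<in> S \<Longrightarrow> (f has_derivative dder f x) (at x)"
  by (simp add: smooth_on_differentiable has_derivative_dder)

lemma smooth_on_dder: "smooth_on S f \<Longrightarrow> smooth_on S (\<lambda>x. dder f x v)"
  unfolding smooth_on_def using diff_times.simps(2) by blast

lemma smooth_on_imp_continuous_on: "smooth_on S f \<Longrightarrow> continuous_on S f"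
  unfolding smooth_on_def by (metis diff_times.simps(1))

lemma smooth_on_subset:
  assumes "smooth_on S f" "T \<subseteq> S"
  shows "smooth_on T f"
proof -
  have "diff_times S f k \<Longrightarrow> diff_times T f k" for k
    using assms(2) by (induction k arbitrary: f) (auto intro: continuous_on_subset)
  then show ?thesis using assms(1) unfolding smooth_on_def by blast
qed

lemma smooth_on_const: "smooth_on S (\<lambda>x. c)"
proof -
  have "diff_times S (\<lambda>x. c) k" for k
  proof (induction k arbitrary: c)
    case (Suc k)
    have "dder (\<lambda>x::'a. c) x v = 0" for x v by (rule dder_eqI) (rule has_derivative_const)
    then show ?case using Suc by simp
  qed simp
  then show ?thesis by (simp add: smooth_on_def)
qed

lemma smooth_on_ident: "smooth_on S (\<lambda>x. x)"
proof -
  have "dder (\<lambda>x. x) x v = v" for x v :: 'a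
    by (rule dder_eqI) (rule has_derivative_ident)
  then have "diff_times S (\<lambda>x. x) k" for k
    using smooth_on_const[of S] by (cases k) (auto simp: smooth_on_def)
  then show ?thesis by (simp add: smooth_on_def)
qed

lemma diff_times_bounded_linear:
  assumes "open S" "bounded_linear h" "diff_times S f k"
  shows "diff_times S (\<lambda>x. h (f x)) k"
  using assms(3)
proof (induction k arbitrary: f)
  case 0
  then show ?case using bounded_linear.continuous_on[OF assms(2)] by simp
next
  case (Suc k)
  have D: "((\<lambda>x. h (f x)) has_derivative (\<lambda>v. h (dder f x v))) (at x)" if "x \<in> S" for x
    using Suc.prems that by (intro bounded_linear.has_derivative[OF assms(2)] has_derivative_dder) auto
  have "diff_times S (\<lambda>x. dder (\<lambda>x. h (f x)) x v) k" for v
  proof (subst diff_times_cong[OF assms(1)])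
    show "dder (\<lambda>x. h (f x)) y v = h (dder f y v)" if "y \<in> S" for y
      by (rule dder_eqI[OF D[OF that]])
    show "diff_times S (\<lambda>x. h (dder f x v)) k" using Suc by simp
  qed
  then show ?case using D by (auto simp: differentiable_def)
qed

lemma smooth_on_bounded_linear:
  assumes "smooth_on S f" "open S" "bounded_linear h"
  shows "smooth_on S (\<lambda>x. h (f x))"
  using assms diff_times_bounded_linear unfolding smooth_on_def by blast

lemma diff_times_add:
  assumes "open S" "diff_times S f k" "diff_times S g k"
  shows "diff_times S (\<lambda>x. f x + g x) k"
  using assms(2,3)
proof (induction k arbitrary: f g)
  case 0
  then show ?case by (simp add: continuous_on_add)
next
  case (Suc k)
  have D: "((\<lambda>x. f x + g x) has_derivative (\<lambda>v. dder f x v + dder g x v)) (at x)" if "x \<in> S" for x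
    using Suc.prems that by (intro has_derivative_add has_derivative_dder) auto
  have "diff_times S (\<lambda>x. dder (\<lambda>x. f x + g x) x v) k" for v
  proof (subst diff_times_cong[OF assms(1)])
    show "dder (\<lambda>x. f x + g x) y v = dder f y v + dder g y v" if "y \<in> S" for y
      by (rule dder_eqI[OF D[OF that]])
    show "diff_times S (\<lambda>x. dder f x v + dder g x v) k" using Suc by simp
  qed
  then show ?case using D by (auto simp: differentiable_def)
qed

lemma diff_times_bounded_bilinear:
  assumes "bounded_bilinear h" "open S" "diff_times S f k" "diff_times S g k"
  shows "diff_times S (\<lambda>x. h (f x) (g x)) k"
  using assms(3,4)
proof (induction k arbitrary: f g)
  case 0
  then show ?case using bounded_bilinear.continuous_on[OF assms(1)] by simp
next
  case (Suc k)
  have D: "((\<lambda>x. h (f x) (g x)) has_derivative (\<lambda>v. h (f x) (dder g x v) + h (dder f x v) (g x))) (at x)"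
    if "x \<in> S" for x
    using Suc.prems that by (intro bounded_bilinear.FDERIV[OF assms(1)] has_derivative_dder) auto
  have "diff_times S (\<lambda>x. dder (\<lambda>x. h (f x) (g x)) x v) k" for v
  proof (subst diff_times_cong[OF assms(2)])
    show "dder (\<lambda>x. h (f x) (g x)) y v = h (f y) (dder g y v) + h (dder f y v) (g y)" if "y \<in> S" for y
      by (rule dder_eqI[OF D[OF that]])
    show "diff_times S (\<lambda>y. h (f y) (dder g y v) + h (dder f y v) (g y)) k"
      using Suc.prems diff_times_SucD[OF Suc.prems(1)] diff_times_SucD[OF Suc.prems(2)]
      by (intro diff_times_add[OF assms(2)] Suc.IH) auto
  qed
  then show ?case using D by (auto simp: differentiable_def)
qed

lemma smooth_on_bounded_bilinear:
  assumes "bounded_bilinear h" "smooth_on S f" "smooth_on S g" "open S"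
  shows "smooth_on S (\<lambda>x. h (f x) (g x))"
  using assms diff_times_bounded_bilinear unfolding smooth_on_def by blast

lemma smooth_on_add:
  "smooth_on S f \<Longrightarrow> smooth_on S g \<Longrightarrow> open S \<Longrightarrow> smooth_on S (\<lambda>x. f x + g x)"
  using diff_times_add unfolding smooth_on_def by blast

lemmas smooth_on_mult = smooth_on_bounded_bilinear[OF bounded_bilinear_mult]
lemmas smooth_on_scaleR = smooth_on_bounded_bilinear[OF bounded_bilinear_scaleR]
lemmas smooth_on_inner = smooth_on_bounded_bilinear[OF bounded_bilinear_inner]

lemma smooth_on_minus: "smooth_on S f \<Longrightarrow> open S \<Longrightarrow> smooth_on S (\<lambda>x. - f x)"
  by (rule smooth_on_bounded_linear[OF _ _ bounded_linear_minus[OF bounded_linear_ident]])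

lemma smooth_on_diff:
  "smooth_on S f \<Longrightarrow> smooth_on S g \<Longrightarrow> open S \<Longrightarrow> smooth_on S (\<lambda>x. f x - g x)"
  using smooth_on_add[of S f "\<lambda>x. - g x"] smooth_on_minus[of S g] by simp

lemma smooth_on_sum:
  "finite I \<Longrightarrow> (\<And>i. i \<in> I \<Longrightarrow> smooth_on S (f i)) \<Longrightarrow> open S \<Longrightarrow> smooth_on S (\<lambda>x. \<Sum>i\<in>I. f i x)"
  by (induction I rule: finite_induct) (auto intro: smooth_on_add smooth_on_const)

lemma smooth_on_inverse:
  fixes f :: "'a::real_normed_vector \<Rightarrow> real"
  assumes "smooth_on S f" "open S" "\<And>x. x \<in> S \<Longrightarrow> f x \<noteq> 0"
  shows "smooth_on S (\<lambda>x. inverse (f x))"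
proof -
  have "diff_times S (\<lambda>x. inverse (f x)) k" for k
  proof (induction k)
    case 0
    then show ?case
      using smooth_on_imp_continuous_on[OF assms(1)] assms(3) by (simp add: continuous_on_inverse)
  next
    case (Suc k)
    have D: "((\<lambda>x. inverse (f x)) has_derivative (\<lambda>v. - (inverse (f x) * dder f x v * inverse (f x)))) (at x)"
      if "x \<in> S" for x
      using Deriv.has_derivative_inverse[OF assms(3)[OF that] smooth_on_has_derivative[OF assms(1) that]] .
    have "diff_times S (\<lambda>x. dder (\<lambda>x. inverse (f x)) x v) k" for v
    proof (subst diff_times_cong[OF assms(2)])
      show "dder (\<lambda>x. inverse (f x)) y v = - (inverse (f y) * dder f y v * inverse (f y))" if "y \<in> S" for y
        by (rule dder_eqI[OF D[OF that]])
      show "diff_times S (\<lambda>y. - (inverse (f y) * dder f y v * inverse (f y))) k"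
        using smooth_on_dder[OF assms(1)] Suc unfolding smooth_on_def
        by (intro diff_times_bounded_linear[OF assms(2) bounded_linear_minus[OF bounded_linear_ident]]
            diff_times_bounded_bilinear[OF bounded_bilinear_mult assms(2)]) auto
    qed
    then show ?case using D by (auto simp: differentiable_def)
  qed
  then show ?thesis by (simp add: smooth_on_def)
qed

lemma smooth_on_divide:
  fixes f g :: "'a::real_normed_vector \<Rightarrow> real"
  assumes "smooth_on S f" "smooth_on S g" "open S" "\<And>x. x \<in> S \<Longrightarrow> g x \<noteq> 0"
  shows "smooth_on S (\<lambda>x. f x / g x)"
  unfolding divide_inverse by (intro smooth_on_mult smooth_on_inverse assms)

lemma bounded_bilinear_cross3: "bounded_bilinear cross3"
  using bilinear_cross bilinear_conv_bounded_bilinear by blast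

lemmas smooth_on_cross3 = smooth_on_bounded_bilinear[OF bounded_bilinear_cross3]

lemma linear_dder: "f differentiable at x \<Longrightarrow> linear (dder f x)"
  using has_derivative_dder has_derivative_linear by blast

lemma dder_basis_expansion:
  fixes f :: "'a::euclidean_space \<Rightarrow> 'b::real_normed_vector"
  assumes "f differentiable at x"
  shows "dder f x v = (\<Sum>b\<in>Basis. (v \<bullet> b) *\<^sub>R dder f x b)"
proof -
  interpret linear "dder f x" by (rule linear_dder[OF assms])
  have "dder f x v = dder f x (\<Sum>b\<in>Basis. (v \<bullet> b) *\<^sub>R b)" by (simp add: euclidean_representation)
  then show ?thesis by (simp add: sum scale)
qed

lemma smooth_on_dder_field:
  fixes f :: "'a::euclidean_space \<Rightarrow> 'b::real_normed_vector"
  assumes "smooth_on S f" "smooth_on S w" "open S"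
  shows "smooth_on S (\<lambda>x. dder f x (w x))"
proof -
  have b: "smooth_on S (\<lambda>x. (w x \<bullet> b) *\<^sub>R dder f x b)" for b
    by (rule smooth_on_scaleR[OF smooth_on_inner[OF assms(2) smooth_on_const assms(3)]
          smooth_on_dder[OF assms(1)] assms(3)])
  have "smooth_on S (\<lambda>x. \<Sum>b\<in>Basis. (w x \<bullet> b) *\<^sub>R dder f x b)"
    by (rule smooth_on_sum[OF finite_Basis b assms(3)])
  then show ?thesis
    by (rule smooth_on_cong[OF _ assms(3)])
      (rule dder_basis_expansion[OF smooth_on_differentiable[OF assms(1)], symmetric])
qed

text \<open>The second difference is symmetric in \<open>v\<close> and \<open>w\<close>, so this form of the mean value theorem
  yields the symmetry of second derivatives.\<close>

lemma second_difference_mvt: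
  fixes f :: "'a::real_normed_vector \<Rightarrow> real"
  assumes "smooth_on S f" "h > 0"
    and S: "\<And>a b. a \<in> {0..h} \<Longrightarrow> b \<in> {0..h} \<Longrightarrow> x + a *\<^sub>R v + b *\<^sub>R w \<in> S"
  shows "\<exists>a\<in>{0..h}. \<exists>b\<in>{0..h}. f (x + h *\<^sub>R v + h *\<^sub>R w) - f (x + h *\<^sub>R v) - f (x + h *\<^sub>R w) + f x
           = h * (h * dder (\<lambda>y. dder f y v) (x + a *\<^sub>R v + b *\<^sub>R w) w)"
proof -
  have D: "(f has_derivative dder f (x + a *\<^sub>R v + b *\<^sub>R w)) (at (x + a *\<^sub>R v + b *\<^sub>R w))"
    if "a \<in> {0..h}" "b \<in> {0..h}" for a b
    using smooth_on_has_derivative[OF assms(1) S[OF that]] .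
  have Dv: "((\<lambda>y. dder f y v) has_derivative dder (\<lambda>y. dder f y v) (x + a *\<^sub>R v + b *\<^sub>R w))
      (at (x + a *\<^sub>R v + b *\<^sub>R w))" if "a \<in> {0..h}" "b \<in> {0..h}" for a b
    using smooth_on_has_derivative[OF smooth_on_dder[OF assms(1)] S[OF that]] .
  have line: "((\<lambda>t. x + t *\<^sub>R v + b *\<^sub>R w) has_derivative (\<lambda>s. s *\<^sub>R v)) (at a)" for a b
    by (auto intro!: derivative_eq_intros)
  have line': "((\<lambda>t. x + a *\<^sub>R v + t *\<^sub>R w) has_derivative (\<lambda>s. s *\<^sub>R w)) (at b)" for a b
    by (auto intro!: derivative_eq_intros)
  have scale: "dder f (x + a *\<^sub>R v + b *\<^sub>R w) (s *\<^sub>R v) = s * dder f (x + a *\<^sub>R v + b *\<^sub>R w) v"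
    if "a \<in> {0..h}" "b \<in> {0..h}" for a b s
    using linear_scale[OF has_derivative_linear[OF D[OF that]], of s v] by simp
  have scale': "dder (\<lambda>y. dder f y v) (x + a *\<^sub>R v + b *\<^sub>R w) (s *\<^sub>R w)
      = s * dder (\<lambda>y. dder f y v) (x + a *\<^sub>R v + b *\<^sub>R w) w"
    if "a \<in> {0..h}" "b \<in> {0..h}" for a b s
    using linear_scale[OF has_derivative_linear[OF Dv[OF that]], of s w] by simp
  define \<phi> where "\<phi> t = f (x + t *\<^sub>R v + h *\<^sub>R w) - f (x + t *\<^sub>R v + 0 *\<^sub>R w)" for t
  have \<phi>: "(\<phi> has_derivative (\<lambda>s. s * (dder f (x + a *\<^sub>R v + h *\<^sub>R w) v - dder f (x + a *\<^sub>R v + 0 *\<^sub>R w) v))) (at a)"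
    if a: "a \<in> {0..h}" for a
  proof -
    have h: "h \<in> {0..h}" "0 \<in> {0..h}" using assms(2) by auto
    show ?thesis
      unfolding \<phi>_def right_diff_distrib scale[OF a h(1), symmetric] scale[OF a h(2), symmetric]
      by (intro has_derivative_diff has_derivative_compose[OF line D] a h)
  qed
  obtain a where a: "a \<in> {0<..<h}" "\<phi> h - \<phi> 0
      = (h - 0) * (dder f (x + a *\<^sub>R v + h *\<^sub>R w) v - dder f (x + a *\<^sub>R v + 0 *\<^sub>R w) v)"
    using mvt_simple[OF assms(2) has_derivative_at_withinI[OF \<phi>]] by force
  have ah: "a \<in> {0..h}" using a(1) by auto
  define \<psi> where "\<psi> t = dder f (x + a *\<^sub>R v + t *\<^sub>R w) v" for t
  have \<psi>: "(\<psi> has_derivative (\<lambda>s. s * dder (\<lambda>y. dder f y v) (x + a *\<^sub>R v + b *\<^sub>R w) w)) (at b)"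
    if "b \<in> {0..h}" for b
    unfolding \<psi>_def scale'[OF ah that, symmetric]
    by (rule has_derivative_compose[OF line' Dv[OF ah that]])
  obtain b where b: "b \<in> {0<..<h}" "\<psi> h - \<psi> 0 = (h - 0) * dder (\<lambda>y. dder f y v) (x + a *\<^sub>R v + b *\<^sub>R w) w"
    using mvt_simple[OF assms(2) has_derivative_at_withinI[OF \<psi>]] by force
  have "b \<in> {0..h}" using b(1) by auto
  then show ?thesis
    using ah a(2) b(2) unfolding \<phi>_def \<psi>_def by (intro bexI[of _ a] bexI[of _ b]) auto
qed

lemma dder_commute_real:
  fixes f :: "'a::real_normed_vector \<Rightarrow> real"
  assumes f: "smooth_on S f" and S: "open S" "x \<in> S"
  shows "dder (\<lambda>y. dder f y v) x w = dder (\<lambda>y. dder f y w) x v"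
proof -
  let ?A = "\<lambda>z. dder (\<lambda>y. dder f y v) z w" and ?B = "\<lambda>z. dder (\<lambda>y. dder f y w) z v"
  have "\<bar>?A x - ?B x\<bar> \<le> e" if "e > 0" for e
  proof -
    have "continuous_on S ?A" "continuous_on S ?B"
      by (intro smooth_on_imp_continuous_on smooth_on_dder f)+
    then have "isCont ?A x" "isCont ?B x"
      using S by (simp_all add: continuous_on_eq_continuous_at)
    moreover have "e / 2 > 0" using that by simp
    ultimately have "\<exists>d>0. \<forall>z. dist z x < d \<longrightarrow> dist (?A z) (?A x) < e/2"
      "\<exists>d>0. \<forall>z. dist z x < d \<longrightarrow> dist (?B z) (?B x) < e/2"
      unfolding continuous_at_eps_delta by blast+
    then obtain d1 d2 where d: "d1 > 0" "\<And>z. dist z x < d1 \<Longrightarrow> dist (?A z) (?A x) < e/2"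
        "d2 > 0" "\<And>z. dist z x < d2 \<Longrightarrow> dist (?B z) (?B x) < e/2"
      by blast
    obtain r where r: "r > 0" "ball x r \<subseteq> S" using S openE by blast
    \<comment> \<open>The parallelogram with sides \<open>h v\<close>, \<open>h w\<close> has to stay within distance \<open>m\<close> of \<open>x\<close>.\<close>
    define m where "m = Min {d1, d2, r}"
    have m: "m > 0" "m \<le> d1" "m \<le> d2" "m \<le> r" using d r by (auto simp: m_def)
    define h where "h = m / (2 * (norm v + norm w + 1))"
    have h0: "h > 0" using m by (simp add: h_def add_nonneg_pos)
    have halve: "m / (2 * c) * c = m / 2" if "c > 0" for c :: real using that by simp
    have near: "dist (x + a *\<^sub>R v + b *\<^sub>R w) x < m" if ab: "a \<in> {0..h}" "b \<in> {0..h}" for a b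
    proof -
      have "dist (x + a *\<^sub>R v + b *\<^sub>R w) x \<le> norm (a *\<^sub>R v) + norm (b *\<^sub>R w)"
        using norm_triangle_ineq[of "a *\<^sub>R v" "b *\<^sub>R w"] by (simp add: dist_norm add.assoc)
      also have "\<dots> \<le> h * norm v + h * norm w"
        using ab by (intro add_mono) (auto intro: mult_right_mono)
      also have "\<dots> \<le> h * (norm v + norm w + 1)"
        using h0 by (simp add: algebra_simps)
      also have "\<dots> = m / 2" unfolding h_def by (intro halve) (simp add: add_nonneg_pos)
      also have "\<dots> < m" using m by simp
      finally show ?thesis .
    qed
    have inS: "x + a *\<^sub>R v + b *\<^sub>R w \<in> S" "x + a *\<^sub>R w + b *\<^sub>R v \<in> S"
      if "a \<in> {0..h}" "b \<in> {0..h}" for a b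
      using near[OF that] near[OF that(2,1)] r(2) m(4)
      by (auto simp: subset_eq dist_commute add.commute add.left_commute)
    obtain a b where ab: "a \<in> {0..h}" "b \<in> {0..h}"
      "f (x + h *\<^sub>R v + h *\<^sub>R w) - f (x + h *\<^sub>R v) - f (x + h *\<^sub>R w) + f x = h * (h * ?A (x + a *\<^sub>R v + b *\<^sub>R w))"
      using second_difference_mvt[OF f h0 inS(1)] by blast
    obtain a' b' where ab': "a' \<in> {0..h}" "b' \<in> {0..h}"
      "f (x + h *\<^sub>R w + h *\<^sub>R v) - f (x + h *\<^sub>R w) - f (x + h *\<^sub>R v) + f x = h * (h * ?B (x + a' *\<^sub>R w + b' *\<^sub>R v))"
      using second_difference_mvt[OF f h0 inS(2)] by blast
    have "h * (h * ?A (x + a *\<^sub>R v + b *\<^sub>R w)) = h * (h * ?B (x + a' *\<^sub>R w + b' *\<^sub>R v))"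
      using ab(3) ab'(3) by (simp add: algebra_simps)
    then have "?A (x + a *\<^sub>R v + b *\<^sub>R w) = ?B (x + a' *\<^sub>R w + b' *\<^sub>R v)"
      using h0 by simp
    moreover have "dist (?A (x + a *\<^sub>R v + b *\<^sub>R w)) (?A x) < e/2"
      using near[OF ab(1,2)] m by (intro d) auto
    moreover have "dist (?B (x + a' *\<^sub>R w + b' *\<^sub>R v)) (?B x) < e/2"
      using near[OF ab'(2,1)] m by (intro d) (auto simp: add.commute add.left_commute)
    ultimately have "dist (?A x) (?B x) < e"
      using dist_triangle_half_r[of "?A (x + a *\<^sub>R v + b *\<^sub>R w)" "?A x" e "?B x"] by simp
    then show ?thesis by (simp add: dist_real_def)
  qed
  then have "\<bar>?A x - ?B x\<bar> \<le> 0" by (rule field_le_epsilon) simp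
  then show ?thesis by simp
qed

lemma dder_inner_right:
  fixes f :: "'a::real_normed_vector \<Rightarrow> 'b::real_inner"
  assumes "f differentiable at x"
  shows "dder (\<lambda>y. f y \<bullet> c) x v = dder f x v \<bullet> c"
  by (rule dder_eqI) (intro has_derivative_inner_left has_derivative_dder assms)

text \<open>Schwarz's theorem, reduced to real functions by taking components.\<close>

theorem dder_commute:
  fixes f :: "'a::real_normed_vector \<Rightarrow> 'b::euclidean_space"
  assumes f: "smooth_on S f" and S: "open S" "x \<in> S"
  shows "dder (\<lambda>y. dder f y v) x w = dder (\<lambda>y. dder f y w) x v"
proof (rule euclidean_eqI)
  fix c :: 'b
  have fc: "smooth_on S (\<lambda>y. f y \<bullet> c)" by (intro smooth_on_inner f smooth_on_const S)
  have "dder (\<lambda>y. dder f y a) x b \<bullet> c = dder (\<lambda>y. dder (\<lambda>y. f y \<bullet> c) y a) x b" for a b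
  proof -
    have "dder (\<lambda>y. dder f y a) x b \<bullet> c = dder (\<lambda>y. dder f y a \<bullet> c) x b"
      using smooth_on_differentiable[OF smooth_on_dder[OF f] S(2)] by (simp add: dder_inner_right)
    also have "\<dots> = dder (\<lambda>y. dder (\<lambda>y. f y \<bullet> c) y a) x b"
      using smooth_on_differentiable[OF f]
      by (intro dder_cong_open[OF S]) (simp add: dder_inner_right)
    finally show ?thesis .
  qed
  then show "dder (\<lambda>y. dder f y v) x w \<bullet> c = dder (\<lambda>y. dder f y w) x v \<bullet> c"
    using dder_commute_real[OF fc S] by simp
qed

text \<open>The map \<open>x \<mapsto> df\<^sub>x(w x)\<close> is a product of the coefficients of \<open>w\<close> with the partial derivatives
  of \<open>f\<close>; the product rule separates the second derivative of \<open>f\<close>, which is symmetric, from the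
  derivative of \<open>w\<close>.\<close>

lemma dder_dder_field:
  fixes f :: "'a::euclidean_space \<Rightarrow> 'b::euclidean_space"
  assumes f: "smooth_on S f" and w: "smooth_on S w" and S: "open S" "x \<in> S"
  shows "dder (\<lambda>y. dder f y (w y)) x v = dder (\<lambda>y. dder f y (w x)) x v + dder f x (dder w x v)"
proof -
  have dS: "\<And>y. y \<in> S \<Longrightarrow> f differentiable at y" by (rule smooth_on_differentiable[OF f])
  have E: "((\<lambda>y. \<Sum>b\<in>Basis. (w y \<bullet> b) *\<^sub>R dder f y b) has_derivative
     (\<lambda>v. \<Sum>b\<in>Basis. (w x \<bullet> b) *\<^sub>R dder (\<lambda>y. dder f y b) x v + (dder w x v \<bullet> b) *\<^sub>R dder f x b)) (at x)"
    by (intro has_derivative_sum has_derivative_scaleR has_derivative_inner_left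
        smooth_on_has_derivative[OF w S(2)] smooth_on_has_derivative[OF smooth_on_dder[OF f] S(2)])
  have E': "((\<lambda>y. \<Sum>b\<in>Basis. (w x \<bullet> b) *\<^sub>R dder f y b) has_derivative
     (\<lambda>v. \<Sum>b\<in>Basis. (w x \<bullet> b) *\<^sub>R dder (\<lambda>y. dder f y b) x v)) (at x)"
    by (intro has_derivative_sum has_derivative_scaleR_right
        smooth_on_has_derivative[OF smooth_on_dder[OF f] S(2)])
  have "dder (\<lambda>y. dder f y (w y)) x v = dder (\<lambda>y. \<Sum>b\<in>Basis. (w y \<bullet> b) *\<^sub>R dder f y b) x v"
    by (rule dder_cong_open[OF S]) (rule dder_basis_expansion[OF dS])
  moreover have "dder (\<lambda>y. dder f y (w x)) x v = dder (\<lambda>y. \<Sum>b\<in>Basis. (w x \<bullet> b) *\<^sub>R dder f y b) x v"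
    by (rule dder_cong_open[OF S]) (rule dder_basis_expansion[OF dS])
  ultimately show ?thesis
    using dder_basis_expansion[OF dS[OF S(2)], of "dder w x v"]
    by (simp add: dder_eqI[OF E] dder_eqI[OF E'] sum.distrib)
qed

text \<open>Symmetry of the second derivative leaves only the derivatives of the two fields.\<close>

lemma dder_field_bracket:
  fixes f :: "real^2 \<Rightarrow> 'b::euclidean_space"
  assumes f: "smooth_on S f" and w: "smooth_on S w1" "smooth_on S w2" and S: "open S" "x \<in> S"
  shows "dder (\<lambda>y. dder f y (w2 y)) x (w1 x) - dder (\<lambda>y. dder f y (w1 y)) x (w2 x)
          = dder f x (lie_bracket w1 w2 x)"
  using dder_dder_field[OF f w(1) S, of "w2 x"] dder_dder_field[OF f w(2) S, of "w1 x"]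
    dder_commute[OF f S, of "w1 x" "w2 x"]
    linear_diff[OF linear_dder[OF smooth_on_differentiable[OF f S(2)]]]
  by (simp add: lie_bracket_def)

text \<open>If the second derivative along \<open>v\<close> were positive, \<open>g\<close> would increase from \<open>x\<close> along \<open>v\<close>, as
  its first derivative vanishes at \<open>x\<close>.\<close>

lemma second_derivative_local_max:
  fixes g :: "'a::real_normed_vector \<Rightarrow> real"
  assumes g: "smooth_on S g" and S: "open S" "x \<in> S" and mx: "\<And>y. y \<in> S \<Longrightarrow> g y \<le> g x"
  shows "dder (\<lambda>y. dder g y v) x v \<le> 0"
proof (rule ccontr)
  assume neg: "\<not> ?thesis"
  have d0: "dder g x = (\<lambda>v. 0)"
    using differential_zero_maxmin[OF S(2,1) smooth_on_has_derivative[OF g S(2)]] mx by blast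
  define T where "T = (\<lambda>t::real. x + t *\<^sub>R v) -` S"
  have T: "open T" "0 \<in> T"
    unfolding T_def using S by (auto intro!: open_vimage continuous_intros)
  have line: "((\<lambda>t. x + t *\<^sub>R v) has_derivative (\<lambda>s. s *\<^sub>R v)) (at t)" for t
    by (auto intro!: derivative_eq_intros)
  have D: "DERIV (\<lambda>t. h (x + t *\<^sub>R v)) t :> dder h (x + t *\<^sub>R v) v"
    if "smooth_on S h" "t \<in> T" for h :: "'a \<Rightarrow> real" and t
  proof -
    have H: "(h has_derivative dder h (x + t *\<^sub>R v)) (at (x + t *\<^sub>R v))"
      using that by (intro smooth_on_has_derivative[of S]) (auto simp: T_def)
    show ?thesis
      using has_derivative_compose[OF line H] linear_scale[OF has_derivative_linear[OF H], of _ v]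
      by (simp add: has_field_derivative_def mult_commute_abs)
  qed
  have D2: "DERIV (\<lambda>t. dder g (x + t *\<^sub>R v) v) 0 :> dder (\<lambda>y. dder g y v) x v"
    using D[OF smooth_on_dder[OF g] T(2), of v] by simp
  obtain d where d: "d > 0" "\<And>h. h > 0 \<Longrightarrow> h < d \<Longrightarrow> dder g (x + h *\<^sub>R v) v > 0"
    using DERIV_pos_inc_right[OF D2] neg d0 by auto
  obtain r where r: "r > 0" "ball 0 r \<subseteq> T" using T openE by blast
  define b where "b = min d r / 2"
  have b: "b > 0" "b < d" "b < r" using d r by (auto simp: b_def)
  have bT: "t \<in> T" if "0 \<le> t" "t \<le> b" for t
    using r(2) b that by (auto simp: subset_eq dist_real_def)
  obtain z where z: "z > 0" "z < b" "g (x + b *\<^sub>R v) - g (x + 0 *\<^sub>R v) = (b - 0) * dder g (x + z *\<^sub>R v) v"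
    using MVT2[OF b(1) D[OF g bT]] by blast
  have "b \<in> T" using bT b by simp
  then have "g (x + b *\<^sub>R v) \<le> g x" using mx by (simp add: T_def)
  moreover have "dder g (x + z *\<^sub>R v) v > 0" using d z b by auto
  then have "b * dder g (x + z *\<^sub>R v) v > 0" using b by simp
  ultimately show False using z(3) by simp
qed

section \<open>Linear algebra of tangent planes\<close>

lemma real2_expansion: "w = w $ 1 *\<^sub>R axis 1 1 + w $ 2 *\<^sub>R axis 2 1" for w :: "real^2"
  by (simp add: vec_eq_iff forall_2 axis_def)

lemma linear_real2: "linear L \<Longrightarrow> L w = w $ 1 *\<^sub>R L (axis 1 1) + w $ 2 *\<^sub>R L (axis 2 1)"
  for L :: "real^2 \<Rightarrow> 'b::real_vector"
  by (subst real2_expansion) (simp only: linear_add linear_scale)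

lemma cross3_expansion:
  fixes a b x :: "real^3"
  defines "n \<equiv> cross3 a b"
  shows "(n \<bullet> n) *\<^sub>R x = (cross3 x b \<bullet> n) *\<^sub>R a + (cross3 a x \<bullet> n) *\<^sub>R b + (x \<bullet> n) *\<^sub>R n"
  unfolding n_def by (simp add: cross3_simps forall_3)

text \<open>Cramer's rule for a vector in the plane of \<open>a\<close> and \<open>b\<close>.\<close>

lemma cross3_coordinates:
  fixes a b x :: "real^3"
  defines "n \<equiv> cross3 a b"
  assumes "n \<noteq> 0" "x \<bullet> n = 0"
  shows "x = (cross3 x b \<bullet> n / (n \<bullet> n)) *\<^sub>R a + (cross3 a x \<bullet> n / (n \<bullet> n)) *\<^sub>R b"
proof -
  have "x = (1 / (n \<bullet> n)) *\<^sub>R ((n \<bullet> n) *\<^sub>R x)" using assms(2) by simp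
  also have "(n \<bullet> n) *\<^sub>R x = (cross3 x b \<bullet> n) *\<^sub>R a + (cross3 a x \<bullet> n) *\<^sub>R b"
    using cross3_expansion[of a b x] assms(3) by (simp add: n_def)
  finally show ?thesis by (simp add: scaleR_add_right)
qed

lemma cross3_parallel:
  fixes a b n :: "real^3"
  assumes "n \<noteq> 0" "a \<bullet> n = 0" "b \<bullet> n = 0"
  shows "\<exists>t. cross3 a b = t *\<^sub>R n"
proof -
  have "cross3 n (cross3 a b) = (n \<bullet> b) *\<^sub>R a - (n \<bullet> a) *\<^sub>R b"
    by (simp add: cross3_simps forall_3)
  then have "cross3 n (cross3 a b) = 0" using assms by (simp add: inner_commute)
  then have "collinear {0, n, cross3 a b}" by (simp add: cross_eq_0)
  then show ?thesis
    using assms(1) unfolding collinear_lemma by (metis scaleR_zero_left)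
qed

lemma cross3_independent:
  assumes "cross3 a b \<noteq> 0" "x *\<^sub>R a + y *\<^sub>R b = x' *\<^sub>R a + y' *\<^sub>R b"
  shows "x = x'" "y = y'"
proof -
  have "cross3 (x *\<^sub>R a + y *\<^sub>R b) b = cross3 (x' *\<^sub>R a + y' *\<^sub>R b) b"
    "cross3 a (x *\<^sub>R a + y *\<^sub>R b) = cross3 a (x' *\<^sub>R a + y' *\<^sub>R b)"
    using assms(2) by simp_all
  then show "x = x'" "y = y'"
    using assms(1) by (simp_all add: cross_add_left cross_add_right cross_mult_left cross_mult_right)
qed

lemma cross3_linear_image_nonzero:
  fixes L :: "real^2 \<Rightarrow> real^3"
  assumes "linear L" "inj L"
  shows "cross3 (L (axis 1 1)) (L (axis 2 1)) \<noteq> 0"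
proof
  assume "cross3 (L (axis 1 1)) (L (axis 2 1)) = 0"
  then have "L (axis 1 1) = 0 \<or> L (axis 2 1) = 0 \<or> (\<exists>c. L (axis 2 1) = c *\<^sub>R L (axis 1 1))"
    by (simp add: cross_eq_0 collinear_lemma)
  then have "L (axis 1 1) = L 0 \<or> L (axis 2 1) = L 0 \<or> (\<exists>c. L (axis 2 1) = L (c *\<^sub>R axis 1 1))"
    by (simp add: linear_0[OF assms(1)] linear_scale[OF assms(1)])
  then have "(axis 1 1 :: real^2) = 0 \<or> (axis 2 1 :: real^2) = 0 \<or> (\<exists>c. (axis 2 1 :: real^2) = c *\<^sub>R axis 1 1)"
    using assms(2) by (metis injD)
  then show False by (auto simp: vec_eq_iff forall_2 axis_def)
qed

text \<open>The hypothesis \<open>sym\<close> says that the matrix with rows \<open>(p, q)\<close> and \<open>(r, s)\<close> is self-adjoint for the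
  definite form \<open>(g\<^sub>i\<^sub>j)\<close>. Completing the square, \<open>g11\<^sup>2\<close> times the discriminant of its characteristic
  polynomial becomes a sum of two non-negative terms, which vanish together only for scalar
  matrices.\<close>

lemma self_adjoint_discriminant:
  fixes p q r s g11 g12 g22 :: real
  assumes pos: "g11 * g22 - g12\<^sup>2 > 0" and sym: "g12 * p + g22 * r = g11 * q + g12 * s"
  shows "(p - s)\<^sup>2 + 4 * q * r \<ge> 0"
    and "(p - s)\<^sup>2 + 4 * q * r = 0 \<Longrightarrow> p = s \<and> q = 0 \<and> r = 0"
proof -
  have g: "g11 \<noteq> 0" using pos by auto
  have sq: "g11 * q = g12 * (p - s) + g22 * r" using sym by (simp add: algebra_simps)
  have "g11\<^sup>2 * ((p - s)\<^sup>2 + 4 * q * r) = g11\<^sup>2 * (p - s)\<^sup>2 + 4 * g11 * r * (g11 * q)"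
    by (simp add: algebra_simps power2_eq_square)
  also have "\<dots> = (g11 * (p - s) + 2 * g12 * r)\<^sup>2 + 4 * (r\<^sup>2 * (g11 * g22 - g12\<^sup>2))"
    unfolding sq by (simp add: algebra_simps power2_eq_square)
  finally have id: "g11\<^sup>2 * ((p - s)\<^sup>2 + 4 * q * r)
      = (g11 * (p - s) + 2 * g12 * r)\<^sup>2 + 4 * (r\<^sup>2 * (g11 * g22 - g12\<^sup>2))" .
  have nn: "r\<^sup>2 * (g11 * g22 - g12\<^sup>2) \<ge> 0" using pos by simp
  have "g11\<^sup>2 * ((p - s)\<^sup>2 + 4 * q * r) \<ge> 0" unfolding id using nn by simp
  then show "(p - s)\<^sup>2 + 4 * q * r \<ge> 0" using g by (simp add: zero_le_mult_iff)
  assume "(p - s)\<^sup>2 + 4 * q * r = 0"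
  then have "(g11 * (p - s) + 2 * g12 * r)\<^sup>2 + 4 * (r\<^sup>2 * (g11 * g22 - g12\<^sup>2)) = 0"
    using id by simp
  then have "r\<^sup>2 * (g11 * g22 - g12\<^sup>2) = 0" "(g11 * (p - s) + 2 * g12 * r)\<^sup>2 = 0"
    using nn zero_le_power2[of "g11 * (p - s) + 2 * g12 * r"] by linarith+
  then have "r = 0" "p = s" using pos g by auto
  then show "p = s \<and> q = 0 \<and> r = 0" using sq g by simp
qed

lemma char_poly_2x2:
  fixes p q r s l :: real
  shows "(\<exists>x y. (x \<noteq> 0 \<or> y \<noteq> 0) \<and> p * x + q * y = l * x \<and> r * x + s * y = l * y)
     \<longleftrightarrow> (p - l) * (s - l) - q * r = 0" (is "?L \<longleftrightarrow> ?R")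
proof
  assume ?L
  then obtain x y where xy: "x \<noteq> 0 \<or> y \<noteq> 0" "(p - l) * x + q * y = 0" "r * x + (s - l) * y = 0"
    by (auto simp: algebra_simps)
  have "((p - l) * (s - l) - q * r) * x = (s - l) * ((p - l) * x + q * y) - q * (r * x + (s - l) * y)"
    "((p - l) * (s - l) - q * r) * y = (p - l) * (r * x + (s - l) * y) - r * ((p - l) * x + q * y)"
    by (simp_all add: algebra_simps)
  then show ?R using xy by auto
next
  assume R: ?R
  \<comment> \<open>A vector orthogonal to a non-zero row of a singular matrix lies in its kernel.\<close>
  show ?L
  proof (cases "q = 0 \<and> p = l")
    case False
    then show ?thesis using R by (intro exI[of _ "- q"] exI[of _ "p - l"]) (auto simp: algebra_simps)
  next
    case True
    then show ?thesis
    proof (cases "s = l \<and> r = 0")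
      case True
      then show ?thesis using \<open>q = 0 \<and> p = l\<close> by (intro exI[of _ 1] exI[of _ 0]) auto
    next
      case False
      then show ?thesis using \<open>q = 0 \<and> p = l\<close>
        by (intro exI[of _ "s - l"] exI[of _ "- r"]) (auto simp: algebra_simps)
    qed
  qed
qed

lemma quadratic_roots_trace_det:
  fixes p q r s l :: real
  defines "D \<equiv> (p - s)\<^sup>2 + 4 * q * r"
  assumes "D \<ge> 0"
  shows "(p - l) * (s - l) - q * r = 0 \<longleftrightarrow> l = (p + s + sqrt D) / 2 \<or> l = (p + s - sqrt D) / 2"
proof -
  have "4 * ((p - l) * (s - l) - q * r) = (2 * l - (p + s))\<^sup>2 - D"
    by (simp add: D_def algebra_simps power2_eq_square)
  also have "\<dots> = (2 * l - (p + s) - sqrt D) * (2 * l - (p + s) + sqrt D)"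
    using assms(2) by (simp add: algebra_simps power2_eq_square)
  finally have "(p - l) * (s - l) - q * r = 0
    \<longleftrightarrow> (2 * l - (p + s) - sqrt D) = 0 \<or> (2 * l - (p + s) + sqrt D) = 0"
    by (metis mult_eq_0_iff zero_neq_numeral)
  then show ?thesis by (auto simp: field_simps)
qed

section \<open>Graph patches\<close>

lemma isometry_adjoint_inverse:
  fixes A :: "'a::euclidean_space \<Rightarrow> 'b::euclidean_space"
  assumes "linear A" "\<And>z. norm (A z) = norm z"
  shows "adjoint A (A z) = z"
proof (rule euclidean_eqI)
  fix b :: 'a
  have inner: "A x \<bullet> A y = x \<bullet> y" for x y
    using assms(2)[of "x + y"] assms(2)[of x] assms(2)[of y]
    by (simp add: dot_norm linear_add[OF assms(1)])
  show "adjoint A (A z) \<bullet> b = z \<bullet> b"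
    using adjoint_works[OF assms(1), of b "A z"] inner[of z b] by (simp add: inner_commute)
qed

lemma graph_patch_smooth:
  assumes "graph_patch S V Y"
  shows "smooth_on V Y"
proof -
  obtain A :: "(real^2) \<times> real \<Rightarrow> real^3" and g where A: "linear A" "open V" "smooth_on V g" "Y = (\<lambda>u. A (u, g u))"
    using assms unfolding graph_patch_def by blast
  have bl: "bounded_linear A" using A(1) linear_conv_bounded_linear by blast
  have "bounded_linear (\<lambda>u. A (u, 0))" "bounded_linear (\<lambda>t. A (0, t))"
    by (intro bounded_linear_compose[OF bl] bounded_linear_Pair bounded_linear_ident bounded_linear_zero)+
  then have "smooth_on V (\<lambda>u. A (u, 0) + A (0, g u))"
    by (intro smooth_on_add smooth_on_bounded_linear[where h = "\<lambda>u. A (u, 0)"] smooth_on_ident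
        smooth_on_bounded_linear[where h = "\<lambda>t. A (0, t)"] A)
  then show ?thesis
    using A(4) linear_add[OF A(1), of "(u, 0)" "(0, g u)" for u] by simp
qed

text \<open>Orthogonal projection to the coordinate plane is a smooth left inverse of a graph patch, so a
  smooth map into \<open>S\<close> factors smoothly through the patch near any point it sends there.\<close>

lemma smooth_lift_to_graph_patch:
  fixes E :: "real^2 \<Rightarrow> real^3"
  assumes P: "graph_patch S V' Y" and E: "smooth_on V E" "open V" "E ` V \<subseteq> S" and u: "u \<in> V" "E u \<in> Y ` V'"
  obtains D \<phi> where "open D" "u \<in> D" "D \<subseteq> V" "smooth_on D \<phi>" "\<phi> ` D \<subseteq> V'" "\<And>v. v \<in> D \<Longrightarrow> Y (\<phi> v) = E v"
proof -
  obtain A :: "(real^2) \<times> real \<Rightarrow> real^3" and g W where A: "linear A" "\<And>z. norm (A z) = norm z"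
      "open W" "S \<inter> W = Y ` V'" "Y = (\<lambda>u. A (u, g u))"
    using P unfolding graph_patch_def by blast
  define \<phi> where "\<phi> v = fst (adjoint A (E v))" for v
  define D where "D = V \<inter> E -` W"
  have bl: "bounded_linear (\<lambda>x. fst (adjoint A x))"
    using bounded_linear_compose[OF bounded_linear_fst] adjoint_linear[OF A(1)] linear_conv_bounded_linear
    by blast
  have D: "open D"
    unfolding D_def by (rule continuous_open_preimage[OF smooth_on_imp_continuous_on[OF E(1)] E(2) A(3)])
  have key: "\<phi> v \<in> V' \<and> Y (\<phi> v) = E v" if v: "v \<in> D" for v
  proof -
    have "E v \<in> Y ` V'" using v A(4) E(3) unfolding D_def by blast
    then obtain z where z: "z \<in> V'" "E v = Y z" by blast
    have "\<phi> v = z" unfolding \<phi>_def z(2) A(5) isometry_adjoint_inverse[OF A(1,2)] by simp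
    then show ?thesis using z by simp
  qed
  show ?thesis
  proof (rule that)
    show "open D" by (rule D)
    show "u \<in> D" using u A(4) unfolding D_def by blast
    show "D \<subseteq> V" unfolding D_def by blast
    show "smooth_on D \<phi>"
      unfolding \<phi>_def
      by (rule smooth_on_bounded_linear[OF smooth_on_subset[OF E(1)] D bl]) (simp add: D_def)
    show "\<phi> ` D \<subseteq> V'" using key by blast
    show "Y (\<phi> v) = E v" if "v \<in> D" for v using key that by blast
  qed
qed

text \<open>The Gauss curvature is formed with the unit normal; another normal rescales the second
  fundamental form, and its determinant keeps its sign. Independence of the partial derivatives
  comes with it, since the curvature formula gives \<open>0\<close> when their cross product vanishes.\<close>

lemma positive_curvature_hessian:
  assumes pc: "positively_curved S" and P: "graph_patch S V Y" and z: "z \<in> V"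
    and n: "n \<noteq> 0" "\<And>w. dder Y z w \<bullet> n = 0"
  defines "B a b \<equiv> dder (\<lambda>x. dder Y x a) z b \<bullet> n"
  shows "B (axis 1 1) (axis 1 1) * B (axis 2 1) (axis 2 1) - (B (axis 1 1) (axis 2 1))\<^sup>2 > 0"
    and "cross3 (dder Y z (axis 1 1)) (dder Y z (axis 2 1)) \<noteq> 0"
proof -
  let ?c = "cross3 (dder Y z (axis 1 1)) (dder Y z (axis 2 1))"
  let ?b = "\<lambda>a b. dder (\<lambda>x. dder Y x a) z b"
  obtain t where t: "?c = t *\<^sub>R n" using cross3_parallel[OF n(1) n(2) n(2)] by blast
  have K: "euclidean_gauss_curvature Y z > 0" using pc P z unfolding positively_curved_def by blast
  show "?c \<noteq> 0"
    using K by (auto simp: euclidean_gauss_curvature_def Let_def)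
  define s where "s = t / norm ?c"
  have s: "?c /\<^sub>R norm ?c = s *\<^sub>R n" by (simp add: s_def t divide_inverse mult.commute)
  let ?x = "dder Y z (axis 1 1)" and ?y = "dder Y z (axis 2 1)"
  have gram: "(?x \<bullet> ?x) * (?y \<bullet> ?y) - (?x \<bullet> ?y)\<^sup>2 \<ge> 0"
    using Cauchy_Schwarz_ineq[of ?x ?y] by simp
  have "(?b (axis 1 1) (axis 1 1) \<bullet> (s *\<^sub>R n)) * (?b (axis 2 1) (axis 2 1) \<bullet> (s *\<^sub>R n))
      - (?b (axis 1 1) (axis 2 1) \<bullet> (s *\<^sub>R n))\<^sup>2 > 0"
    using K gram unfolding euclidean_gauss_curvature_def Let_def s
    by (metis less_le_not_le divide_nonpos_nonneg not_le)
  then have "s\<^sup>2 * (B (axis 1 1) (axis 1 1) * B (axis 2 1) (axis 2 1) - (B (axis 1 1) (axis 2 1))\<^sup>2) > 0"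
    by (simp add: B_def algebra_simps power2_eq_square)
  then show "B (axis 1 1) (axis 1 1) * B (axis 2 1) (axis 2 1) - (B (axis 1 1) (axis 2 1))\<^sup>2 > 0"
    by (simp add: zero_less_mult_iff)
qed

section \<open>Support planes and the Birkhoff normal in a chart\<close>

text \<open>The surface in one chart: \<open>F\<close> is the immersion and \<open>E\<close> its Birkhoff normal, both as functions of
  the parameters.\<close>

locale birkhoff_chart =
  fixes N :: "real^3 \<Rightarrow> real" and V :: "(real^2) set" and F E :: "real^2 \<Rightarrow> real^3"
  assumes norm_N: "admissible_norm N"
    and open_V: "open V"
    and smooth_F: "smooth_on V F"
    and smooth_E: "smooth_on V E"
    and inj_dF: "\<And>u. u \<in> V \<Longrightarrow> inj (dder F u)"
    and E_sphere: "\<And>u. u \<in> V \<Longrightarrow> E u \<in> unit_sphere N"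
    and birkhoff_E: "\<And>u. u \<in> V \<Longrightarrow> birkhoff_orthogonal N (E u) (range (dder F u))"
begin

abbreviation "F1 u \<equiv> dder F u (axis 1 1)"
abbreviation "F2 u \<equiv> dder F u (axis 2 1)"
abbreviation "E1 u \<equiv> dder E u (axis 1 1)"
abbreviation "E2 u \<equiv> dder E u (axis 2 1)"

definition "normal_vec u = cross3 (F1 u) (F2 u)"

lemma linear_dF: "u \<in> V \<Longrightarrow> linear (dder F u)"
  by (intro linear_dder smooth_on_differentiable[OF smooth_F])

lemma linear_dE: "u \<in> V \<Longrightarrow> linear (dder E u)"
  by (intro linear_dder smooth_on_differentiable[OF smooth_E])

lemma normal_vec_nonzero: "u \<in> V \<Longrightarrow> normal_vec u \<noteq> 0"
  unfolding normal_vec_def by (intro cross3_linear_image_nonzero linear_dF inj_dF)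

lemma dF_orthogonal_normal_vec: "u \<in> V \<Longrightarrow> dder F u w \<bullet> normal_vec u = 0"
  by (subst linear_real2[OF linear_dF]) (simp_all add: normal_vec_def inner_add_left dot_cross_self)

lemma smooth_normal_vec: "smooth_on V normal_vec"
  unfolding normal_vec_def by (intro smooth_on_cross3 smooth_on_dder smooth_F open_V)

text \<open>Birkhoff orthogonality in dual form, which turns tangency into a critical point condition.\<close>

lemma supporting_functional:
  assumes "u \<in> V"
  obtains n where "n \<noteq> 0" "\<And>w. dder F u w \<bullet> n = 0" "\<And>x. N x \<le> 1 \<Longrightarrow> n \<bullet> x \<le> n \<bullet> E u"
proof -
  obtain n c where n: "n \<noteq> 0" "(\<lambda>h. E u /\<^sub>R N (E u) + h) ` range (dder F u) = {x. n \<bullet> x = c}"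
      "\<forall>x\<in>unit_ball N. n \<bullet> x \<le> c"
    using birkhoff_E[OF assms] unfolding birkhoff_orthogonal_def supports_def by blast
  have NE: "N (E u) = 1" using E_sphere[OF assms] by (simp add: unit_sphere_def)
  have pl: "n \<bullet> (E u + dder F u w) = c" for w
    using n(2) NE by (auto simp: set_eq_iff)
  have c: "n \<bullet> E u = c" using pl[of 0] linear_0[OF linear_dF[OF assms]] by simp
  show ?thesis
  proof (rule that[OF n(1)])
    show "dder F u w \<bullet> n = 0" for w
      using pl[of w] c by (simp add: inner_add_right inner_commute)
    show "n \<bullet> x \<le> n \<bullet> E u" if "N x \<le> 1" for x
      using n(3) that c by (simp add: unit_ball_def)
  qed
qed

text \<open>The supporting functional, composed with \<open>Y\<close>, has a maximum at \<open>x\<close>. Applied to the Birkhoff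
  normal itself and to patches of the unit sphere, this shows that both are tangent to the plane of \<open>F\<close>
  at \<open>u\<close>.\<close>

lemma tangent_at_support_point:
  fixes Y :: "'a::real_normed_vector \<Rightarrow> real^3"
  assumes u: "u \<in> V" and S: "open S" "x \<in> S" and D: "(Y has_derivative Y') (at x)"
    and Y: "\<And>y. y \<in> S \<Longrightarrow> N (Y y) \<le> 1" "Y x = E u"
  shows "Y' w \<bullet> normal_vec u = 0"
proof -
  obtain n where n: "n \<noteq> 0" "\<And>w. dder F u w \<bullet> n = 0" "\<And>x. N x \<le> 1 \<Longrightarrow> n \<bullet> x \<le> n \<bullet> E u"
    using supporting_functional[OF u] by blast
  have "((\<lambda>y. n \<bullet> Y y) has_derivative (\<lambda>w. n \<bullet> Y' w)) (at x)"
    by (intro has_derivative_inner_right D)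
  then have "(\<lambda>w. n \<bullet> Y' w) = (\<lambda>v. 0)"
    using n(3) Y by (intro differential_zero_maxmin[OF S(2,1)]) auto
  then have "n \<bullet> Y' w = 0" by metis
  moreover obtain t where "normal_vec u = t *\<^sub>R n"
    using cross3_parallel[OF n(1)] n(2) unfolding normal_vec_def by blast
  ultimately show ?thesis by (simp add: inner_commute)
qed

lemma dE_orthogonal_normal_vec:
  assumes "u \<in> V"
  shows "dder E u w \<bullet> normal_vec u = 0"
  by (rule tangent_at_support_point[OF assms open_V assms smooth_on_has_derivative[OF smooth_E assms]])
    (use E_sphere in \<open>auto simp: unit_sphere_def\<close>)

text \<open>The matrix of the shape operator in the frame \<open>F1\<close>, \<open>F2\<close>, by Cramer's rule.\<close>

definition "a11 u = cross3 (E1 u) (F2 u) \<bullet> normal_vec u / (normal_vec u \<bullet> normal_vec u)"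
definition "a21 u = cross3 (F1 u) (E1 u) \<bullet> normal_vec u / (normal_vec u \<bullet> normal_vec u)"
definition "a12 u = cross3 (E2 u) (F2 u) \<bullet> normal_vec u / (normal_vec u \<bullet> normal_vec u)"
definition "a22 u = cross3 (F1 u) (E2 u) \<bullet> normal_vec u / (normal_vec u \<bullet> normal_vec u)"

lemma E_coordinates:
  assumes "u \<in> V"
  shows "E1 u = a11 u *\<^sub>R F1 u + a21 u *\<^sub>R F2 u" "E2 u = a12 u *\<^sub>R F1 u + a22 u *\<^sub>R F2 u"
  using normal_vec_nonzero[OF assms] dE_orthogonal_normal_vec[OF assms]
  unfolding a11_def a21_def a12_def a22_def normal_vec_def by (intro cross3_coordinates; simp)+

lemma smooth_coefficients: "smooth_on V a11" "smooth_on V a21" "smooth_on V a12" "smooth_on V a22"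
  unfolding a11_def a21_def a12_def a22_def
  by (intro smooth_on_divide smooth_on_inner smooth_on_cross3 smooth_on_dder smooth_normal_vec smooth_F smooth_E open_V;
      simp add: normal_vec_nonzero)+

text \<open>Let \<open>Y\<close> be a graph patch of the unit sphere at \<open>E u\<close>, and write \<open>E = Y \<circ> \<phi>\<close> near \<open>u\<close>. The vector
  \<open>\<nu> = F1 \<times> F2\<close> is normal to \<open>F\<close> and also to \<open>Y\<close> along \<open>\<phi>\<close>. Differentiating both orthogonality
  relations expresses the derivative of \<open>\<nu>\<close> on the tangent plane through the second fundamental
  form of \<open>F\<close>, and through that of \<open>Y\<close> composed with \<open>d\<phi>\<close>. The former is symmetric and the latter is
  definite, so the shape operator is self-adjoint for the second fundamental form of \<open>Y\<close>. The
  numbers \<open>g\<^sub>i\<^sub>j\<close> are the coefficients of that form in the frame \<open>F1\<close>, \<open>F2\<close>.\<close>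

lemma shape_operator_symmetrizable:
  assumes u: "u \<in> V"
  shows "\<exists>g11 g12 g22. g11 * g22 - g12\<^sup>2 > 0 \<and>
     g12 * a11 u + g22 * a21 u = g11 * a12 u + g12 * a22 u"
proof -
  have adm: "locally_smooth_graph (unit_sphere N)" "positively_curved (unit_sphere N)"
    using norm_N by (auto simp: admissible_norm_def)
  obtain V' Y where P: "graph_patch (unit_sphere N) V' Y" "E u \<in> Y ` V'"
    using adm(1) E_sphere[OF u] unfolding locally_smooth_graph_def by blast
  have V': "open V'" using P(1) by (simp add: graph_patch_def)
  have YS: "N (Y z) = 1" if "z \<in> V'" for z
    using P(1) that unfolding graph_patch_def unit_sphere_def by blast
  have sY: "smooth_on V' Y" by (rule graph_patch_smooth[OF P(1)])
  obtain D \<phi> where D: "open D" "u \<in> D" "D \<subseteq> V" and s\<phi>: "smooth_on D \<phi>" and \<phi>: "\<phi> ` D \<subseteq> V'"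
      and Y\<phi>: "\<And>v. v \<in> D \<Longrightarrow> Y (\<phi> v) = E v"
    using smooth_lift_to_graph_patch[OF P(1) smooth_E open_V _ u P(2)] E_sphere by blast
  let ?z = "\<phi> u" and ?n = "normal_vec u"
  have z: "?z \<in> V'" using \<phi> D by blast
  have tan: "dder Y (\<phi> v) w \<bullet> normal_vec v = 0" if v: "v \<in> D" for v w
    using tangent_at_support_point[OF _ V' _ smooth_on_has_derivative[OF sY], of v "\<phi> v"] v \<phi> D(3) YS Y\<phi>
    by (simp add: subset_eq)
  define B where "B a b = dder (\<lambda>x. dder Y x a) ?z b \<bullet> ?n" for a b
  have Bcomm: "B a b = B b a" for a b
    unfolding B_def using dder_commute[OF sY V' z] by simp
  have Blin: "linear (B a)" for a
    using linear_dder[OF smooth_on_differentiable[OF smooth_on_dder[OF sY] z], of a]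
    unfolding B_def linear_iff by (simp add: inner_add_left)
  let ?e = "axis 1 1 :: real^2" and ?f = "axis 2 1 :: real^2"
  have Bpos: "B ?e ?e * B ?f ?f - (B ?e ?f)\<^sup>2 > 0" and cY: "cross3 (dder Y ?z ?e) (dder Y ?z ?f) \<noteq> 0"
    using positive_curvature_hessian[OF adm(2) P(1) z normal_vec_nonzero[OF u] tan[OF D(2)]]
    unfolding B_def by blast+
  have eqY: "dder Y ?z w \<bullet> dder normal_vec u j = - B w (dder \<phi> u j)" for w j
  proof -
    have "((\<lambda>v. dder Y (\<phi> v) w) has_derivative (\<lambda>j. dder (\<lambda>x. dder Y x w) ?z (dder \<phi> u j))) (at u)"
      by (rule has_derivative_compose[OF smooth_on_has_derivative[OF s\<phi> D(2)]
            smooth_on_has_derivative[OF smooth_on_dder[OF sY] z]])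
    then have "((\<lambda>v. dder Y (\<phi> v) w \<bullet> normal_vec v) has_derivative
        (\<lambda>j. dder Y ?z w \<bullet> dder normal_vec u j + dder (\<lambda>x. dder Y x w) ?z (dder \<phi> u j) \<bullet> ?n)) (at u)"
      by (intro has_derivative_inner smooth_on_has_derivative[OF smooth_normal_vec u])
    moreover have "((\<lambda>v. dder Y (\<phi> v) w \<bullet> normal_vec v) has_derivative (\<lambda>j. 0)) (at u)"
      by (rule has_derivative_cong_open[OF D(1,2) _ has_derivative_const]) (simp add: tan)
    ultimately have "dder Y ?z w \<bullet> dder normal_vec u j + dder (\<lambda>x. dder Y x w) ?z (dder \<phi> u j) \<bullet> ?n = 0"
      by (rule fun_cong[OF has_derivative_unique])
    then show ?thesis unfolding B_def by linarith
  qed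
  have eqF: "dder F u w \<bullet> dder normal_vec u j = - (dder (\<lambda>x. dder F x w) u j \<bullet> ?n)" for w j
  proof -
    have "((\<lambda>v. dder F v w \<bullet> normal_vec v) has_derivative
        (\<lambda>j. dder F u w \<bullet> dder normal_vec u j + dder (\<lambda>x. dder F x w) u j \<bullet> ?n)) (at u)"
      by (intro has_derivative_inner smooth_on_has_derivative[OF smooth_normal_vec u]
          smooth_on_has_derivative[OF smooth_on_dder[OF smooth_F] u])
    moreover have "((\<lambda>v. dder F v w \<bullet> normal_vec v) has_derivative (\<lambda>j. 0)) (at u)"
      by (rule has_derivative_cong_open[OF open_V u _ has_derivative_const]) (simp add: dF_orthogonal_normal_vec)
    ultimately have "dder F u w \<bullet> dder normal_vec u j + dder (\<lambda>x. dder F x w) u j \<bullet> ?n = 0"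
      by (rule fun_cong[OF has_derivative_unique])
    then show ?thesis by linarith
  qed
  have sym: "dder F u ?f \<bullet> dder normal_vec u ?e = dder F u ?e \<bullet> dder normal_vec u ?f"
    unfolding eqF using dder_commute[OF smooth_F open_V u] by simp
  have linY: "linear (dder Y ?z)" by (intro linear_dder smooth_on_differentiable[OF sY z])
  \<comment> \<open>The tangent planes of \<open>F\<close> and \<open>Y\<close> coincide, so \<open>dF\<close> can be read in the parameters of the patch.\<close>
  have "\<exists>m. dder Y ?z m = dder F u w" for w
  proof -
    obtain t where t: "cross3 (dder Y ?z ?e) (dder Y ?z ?f) = t *\<^sub>R ?n"
      using cross3_parallel[OF normal_vec_nonzero[OF u]] tan[OF D(2)] by blast
    have "dder F u w \<bullet> cross3 (dder Y ?z ?e) (dder Y ?z ?f) = 0"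
      unfolding t using dF_orthogonal_normal_vec[OF u] by simp
    then obtain x y where "dder F u w = x *\<^sub>R dder Y ?z ?e + y *\<^sub>R dder Y ?z ?f"
      using cross3_coordinates[OF cY] by blast
    then show ?thesis
      by (intro exI[of _ "x *\<^sub>R ?e + y *\<^sub>R ?f"]) (simp add: linear_add[OF linY] linear_scale[OF linY])
  qed
  then obtain m1 m2 where m: "dder Y ?z m1 = F1 u" "dder Y ?z m2 = F2 u" by meson
  have "normal_vec u = (m1 $ 1 * m2 $ 2 - m1 $ 2 * m2 $ 1) *\<^sub>R cross3 (dder Y ?z ?e) (dder Y ?z ?f)"
    unfolding normal_vec_def m[symmetric] linear_real2[OF linY, of m1] linear_real2[OF linY, of m2]
    by (simp add: cross_add_left cross_add_right cross_mult_left cross_mult_right algebra_simps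
        cross_skew[of "dder Y ?z ?f" "dder Y ?z ?e"])
  then have det: "m1 $ 1 * m2 $ 2 - m1 $ 2 * m2 $ 1 \<noteq> 0" using normal_vec_nonzero[OF u] by auto
  have injY: "a = b" if "dder Y ?z a = dder Y ?z b" for a b
  proof -
    have "a $ 1 *\<^sub>R dder Y ?z ?e + a $ 2 *\<^sub>R dder Y ?z ?f = b $ 1 *\<^sub>R dder Y ?z ?e + b $ 2 *\<^sub>R dder Y ?z ?f"
      by (simp only: linear_real2[OF linY, symmetric] that)
    from cross3_independent[OF cY this] show ?thesis by (simp add: vec_eq_iff forall_2)
  qed
  have chain: "dder E u j = dder Y ?z (dder \<phi> u j)" for j
  proof (rule dder_eqI)
    show "(E has_derivative (\<lambda>j. dder Y ?z (dder \<phi> u j))) (at u)"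
      by (rule has_derivative_cong_open[OF D(1,2) Y\<phi>
            has_derivative_compose[OF smooth_on_has_derivative[OF s\<phi> D(2)] smooth_on_has_derivative[OF sY z]]])
  qed
  have \<phi>1: "dder \<phi> u ?e = a11 u *\<^sub>R m1 + a21 u *\<^sub>R m2"
    by (rule injY) (simp add: chain[symmetric] E_coordinates[OF u] linear_add[OF linY] linear_scale[OF linY] m)
  have \<phi>2: "dder \<phi> u ?f = a12 u *\<^sub>R m1 + a22 u *\<^sub>R m2"
    by (rule injY) (simp add: chain[symmetric] E_coordinates[OF u] linear_add[OF linY] linear_scale[OF linY] m)
  have "B m2 (dder \<phi> u ?e) = B m1 (dder \<phi> u ?f)"
    using sym eqY[of m2 ?e] eqY[of m1 ?f] m by simp
  then have "B m1 m2 * a11 u + B m2 m2 * a21 u = B m1 m1 * a12 u + B m1 m2 * a22 u"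
    unfolding \<phi>1 \<phi>2
    by (simp add: linear_add[OF Blin] linear_scale[OF Blin] Bcomm[of m2 m1] mult.commute)
  moreover have "B m1 m1 * B m2 m2 - (B m1 m2)\<^sup>2 > 0"
  proof -
    have exp: "B a b = a $ 1 * b $ 1 * B ?e ?e + (a $ 1 * b $ 2 + a $ 2 * b $ 1) * B ?e ?f + a $ 2 * b $ 2 * B ?f ?f" for a b
    proof -
      have "B a b = b $ 1 * B a ?e + b $ 2 * B a ?f" using linear_real2[OF Blin, of a b] by simp
      moreover have "B a ?e = a $ 1 * B ?e ?e + a $ 2 * B ?e ?f"
        using linear_real2[OF Blin, of ?e a] by (simp add: Bcomm[of a ?e])
      moreover have "B a ?f = a $ 1 * B ?e ?f + a $ 2 * B ?f ?f"
        using linear_real2[OF Blin, of ?f a] by (simp add: Bcomm[of a ?f] Bcomm[of ?f ?e])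
      ultimately show ?thesis by (simp add: algebra_simps)
    qed
    have "B m1 m1 * B m2 m2 - (B m1 m2)\<^sup>2
        = (m1 $ 1 * m2 $ 2 - m1 $ 2 * m2 $ 1)\<^sup>2 * (B ?e ?e * B ?f ?f - (B ?e ?f)\<^sup>2)"
      unfolding exp[of m1 m1] exp[of m2 m2] exp[of m1 m2] by (simp add: algebra_simps power2_eq_square)
    then show ?thesis using det Bpos by simp
  qed
  ultimately show ?thesis by blast
qed

text \<open>The discriminant of the characteristic polynomial of the shape operator.\<close>

definition "disc u = (a11 u - a22 u)\<^sup>2 + 4 * a12 u * a21 u"

lemma disc_nonneg: "u \<in> V \<Longrightarrow> disc u \<ge> 0"
  using shape_operator_symmetrizable[of u] self_adjoint_discriminant(1) unfolding disc_def by blast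

lemma disc_zero_scalar:
  assumes "u \<in> V" "disc u = 0"
  shows "dder E u w = a11 u *\<^sub>R dder F u w"
proof -
  have "a11 u = a22 u \<and> a12 u = 0 \<and> a21 u = 0"
    using shape_operator_symmetrizable[OF assms(1)] self_adjoint_discriminant(2) assms(2) unfolding disc_def by blast
  then show ?thesis
    using linear_real2[OF linear_dE[OF assms(1)], of w] linear_real2[OF linear_dF[OF assms(1)], of w]
      E_coordinates[OF assms(1)] by (simp add: scaleR_add_right mult.commute)
qed

lemma continuous_disc: "continuous_on V disc"
  unfolding disc_def by (intro continuous_intros smooth_on_imp_continuous_on smooth_coefficients)

lemma eigenvalues:
  assumes u: "u \<in> V"
  shows "{l. \<exists>w. w \<noteq> 0 \<and> dder E u w = l *\<^sub>R dder F u w}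
    = {(a11 u + a22 u + sqrt (disc u)) / 2, (a11 u + a22 u - sqrt (disc u)) / 2}"
proof -
  have "(\<exists>w. w \<noteq> 0 \<and> dder E u w = l *\<^sub>R dder F u w)
      \<longleftrightarrow> (\<exists>x y. (x \<noteq> 0 \<or> y \<noteq> 0) \<and> a11 u * x + a12 u * y = l * x \<and> a21 u * x + a22 u * y = l * y)" for l
  proof -
    have "dder E u w = l *\<^sub>R dder F u w \<longleftrightarrow>
        a11 u * w $ 1 + a12 u * w $ 2 = l * w $ 1 \<and> a21 u * w $ 1 + a22 u * w $ 2 = l * w $ 2" for w
    proof -
      have "dder E u w = (a11 u * w $ 1 + a12 u * w $ 2) *\<^sub>R F1 u + (a21 u * w $ 1 + a22 u * w $ 2) *\<^sub>R F2 u"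
        using linear_real2[OF linear_dE[OF u], of w] E_coordinates[OF u] by (simp add: algebra_simps)
      moreover have "l *\<^sub>R dder F u w = (l * w $ 1) *\<^sub>R F1 u + (l * w $ 2) *\<^sub>R F2 u"
        using linear_real2[OF linear_dF[OF u], of w] by (simp add: algebra_simps)
      ultimately show ?thesis
        using cross3_independent[of "F1 u" "F2 u"] normal_vec_nonzero[OF u] unfolding normal_vec_def by metis
    qed
    then have "(\<exists>w. w \<noteq> 0 \<and> dder E u w = l *\<^sub>R dder F u w) \<longleftrightarrow> (\<exists>w :: real^2. (w $ 1 \<noteq> 0 \<or> w $ 2 \<noteq> 0) \<and>
        a11 u * w $ 1 + a12 u * w $ 2 = l * w $ 1 \<and> a21 u * w $ 1 + a22 u * w $ 2 = l * w $ 2)"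
      by (simp add: vec_eq_iff forall_2 )
    also have "\<dots> \<longleftrightarrow> (\<exists>x y. (x \<noteq> 0 \<or> y \<noteq> 0) \<and> a11 u * x + a12 u * y = l * x \<and> a21 u * x + a22 u * y = l * y)"
      by (metis vector_2)
    finally show ?thesis .
  qed
  moreover have "(a11 u - l) * (a22 u - l) - a12 u * a21 u = 0
      \<longleftrightarrow> l = (a11 u + a22 u + sqrt (disc u)) / 2 \<or> l = (a11 u + a22 u - sqrt (disc u)) / 2" for l
    unfolding disc_def by (rule quadratic_roots_trace_det) (rule disc_nonneg[OF u, unfolded disc_def])
  ultimately show ?thesis
    by (simp only: char_poly_2x2 set_eq_iff mem_Collect_eq insert_iff empty_iff simp_thms)
qed

lemma max_min_eigenvalue:
  assumes u: "u \<in> V" and L: "L = {l. \<exists>w. w \<noteq> 0 \<and> dder E u w = l *\<^sub>R dder F u w}"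
  shows "Max L = (a11 u + a22 u + sqrt (disc u)) / 2" "Min L = (a11 u + a22 u - sqrt (disc u)) / 2"
  unfolding L eigenvalues[OF u] using disc_nonneg[OF u] by (simp_all add: max_def min_def)

end

section \<open>Codazzi equation\<close>

text \<open>The second derivatives of \<open>E\<close> and of \<open>F\<close> along the commuting fields are symmetric. Expanding
  \<open>w1(l2 w2(F)) = w2(l1 w1(F))\<close> by the product rule gives the equation.\<close>

lemma codazzi_commuting_fields:
  fixes F E :: "real^2 \<Rightarrow> 'b::euclidean_space"
  assumes W: "open W" "x \<in> W"
    and F: "smooth_on W F" and E: "smooth_on W E"
    and w: "smooth_on W w1" "smooth_on W w2" and br: "lie_bracket w1 w2 x = 0"
    and l: "smooth_on W l1" "smooth_on W l2"
    and eig: "\<And>y. y \<in> W \<Longrightarrow> dder E y (w1 y) = l1 y *\<^sub>R dder F y (w1 y)"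
      "\<And>y. y \<in> W \<Longrightarrow> dder E y (w2 y) = l2 y *\<^sub>R dder F y (w2 y)"
  shows "(l1 x - l2 x) *\<^sub>R dder (\<lambda>y. dder F y (w2 y)) x (w1 x)
    = dder l2 x (w1 x) *\<^sub>R dder F x (w2 x) - dder l1 x (w2 x) *\<^sub>R dder F x (w1 x)"
proof -
  have swap: "dder (\<lambda>y. dder G y (w2 y)) x (w1 x) = dder (\<lambda>y. dder G y (w1 y)) x (w2 x)"
    if G: "smooth_on W G" for G :: "real^2 \<Rightarrow> 'b"
    using dder_field_bracket[OF G w W] br linear_0[OF linear_dder[OF smooth_on_differentiable[OF G W(2)]]]
    by simp
  have prod: "dder (\<lambda>y. dder E y (w y)) x v = l x *\<^sub>R dder (\<lambda>y. dder F y (w y)) x v + dder l x v *\<^sub>R dder F x (w x)"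
    if "smooth_on W w" "smooth_on W l" and eq: "\<And>y. y \<in> W \<Longrightarrow> dder E y (w y) = l y *\<^sub>R dder F y (w y)" for w l v
  proof (subst dder_cong_open[OF W eq])
    show "dder (\<lambda>y. l y *\<^sub>R dder F y (w y)) x v
      = l x *\<^sub>R dder (\<lambda>y. dder F y (w y)) x v + dder l x v *\<^sub>R dder F x (w x)"
      by (rule dder_eqI[OF has_derivative_scaleR[OF smooth_on_has_derivative[OF that(2) W(2)]
            smooth_on_has_derivative[OF smooth_on_dder_field[OF F that(1) W(1)] W(2)]]])
  qed
  show ?thesis
    using swap[OF E] swap[OF F] prod[OF w(1) l(1) eig(1), of "w2 x"] prod[OF w(2) l(2) eig(2), of "w1 x"]
    by (simp add: algebra_simps)
qed

section \<open>Strictly convex norms\<close>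

lemma norm_support_functional:
  assumes N: "is_norm N" and z: "N z = 1"
  obtains n where "n \<noteq> 0" "\<And>x. N x \<le> 1 \<Longrightarrow> n \<bullet> x \<le> n \<bullet> z" "n \<bullet> z > 0"
proof -
  have N0: "N x = 0 \<longleftrightarrow> x = 0" "0 \<le> N x" "N (a *\<^sub>R x) = \<bar>a\<bar> * N x" "N (x + y) \<le> N x + N y" for a x y
    using N by (auto simp: is_norm_def)
  have "convex {x. N x < 1}"
  proof (rule convexI)
    fix x y and u v :: real
    assume a: "x \<in> {x. N x < 1}" "y \<in> {x. N x < 1}" "0 \<le> u" "0 \<le> v" "u + v = 1"
    have "N (u *\<^sub>R x + v *\<^sub>R y) \<le> u * N x + v * N y"
      using N0(4)[of "u *\<^sub>R x" "v *\<^sub>R y"] a by (simp add: N0(3))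
    also have "\<dots> < 1" using a convex_bound_lt[of "N x" 1 "N y" u v] by simp
    finally show "u *\<^sub>R x + v *\<^sub>R y \<in> {x. N x < 1}" by simp
  qed
  moreover have "{x. N x < 1} \<noteq> {}" using N0(1)[of 0] by (auto intro!: exI[of _ 0])
  ultimately obtain n b where n: "n \<noteq> 0" "\<forall>x\<in>{x. N x < 1}. n \<bullet> x \<le> b" "\<forall>x\<in>{z}. n \<bullet> x \<ge> b"
    using separating_hyperplane_sets[of "{x. N x < 1}" "{z}"] z by auto
  \<comment> \<open>Separation bounds the functional on the open ball only; boundary points are limits of \<open>t x\<close>, \<open>t < 1\<close>.\<close>
  have le: "n \<bullet> x \<le> n \<bullet> z" if "N x \<le> 1" for x
  proof (rule tendsto_upperbound)
    show "((\<lambda>t. t * (n \<bullet> x)) \<longlongrightarrow> n \<bullet> x) (at_left 1)"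
      by (auto intro!: tendsto_eq_intros)
    have "t * (n \<bullet> x) \<le> n \<bullet> z" if t: "t \<in> {0<..<1}" for t :: real
    proof -
      have "t * N x \<le> t" using t \<open>N x \<le> 1\<close> by (intro mult_left_le) auto
      also have "t < 1" using t by simp
      finally have "t * N x < 1" .
      then have "N (t *\<^sub>R x) < 1" using t by (simp add: N0(3))
      then show ?thesis using n by force
    qed
    then show "\<forall>\<^sub>F t in at_left 1. t * (n \<bullet> x) \<le> n \<bullet> z"
      using eventually_at_leftI[of 0 1 "\<lambda>t. t * (n \<bullet> x) \<le> n \<bullet> z"] by simp
  qed simp
  have "N n > 0" using N0(1,2)[of n] n(1) by (simp add: less_le)
  then have "N ((1 / N n) *\<^sub>R n) = 1" by (simp add: N0(3))
  then have "n \<bullet> ((1 / N n) *\<^sub>R n) \<le> n \<bullet> z" by (intro le) simp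
  moreover have "n \<bullet> ((1 / N n) *\<^sub>R n) > 0" using \<open>N n > 0\<close> n(1) by simp
  ultimately show ?thesis using that[OF n(1) le] by simp
qed

text \<open>The segment between two points of contact lies in the support plane and in the ball, hence in the
  sphere.\<close>

lemma support_point_unique:
  assumes N: "is_norm N" "no_segment (unit_sphere N)"
    and n: "\<And>x. N x \<le> 1 \<Longrightarrow> n \<bullet> x \<le> n \<bullet> z" "n \<bullet> z > 0"
    and z: "N z = 1" and y: "N y = 1" "n \<bullet> y = n \<bullet> z"
  shows "y = z"
proof (rule ccontr)
  assume "y \<noteq> z"
  have N0: "N x = 0 \<longleftrightarrow> x = 0" "0 \<le> N x" "N (a *\<^sub>R x) = \<bar>a\<bar> * N x" "N (x + y) \<le> N x + N y" for a x y
    using N(1) by (auto simp: is_norm_def)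
  have "closed_segment y z \<subseteq> unit_sphere N"
  proof
    fix x assume "x \<in> closed_segment y z"
    then obtain t where t: "0 \<le> t" "t \<le> 1" "x = (1 - t) *\<^sub>R y + t *\<^sub>R z"
      by (auto simp: closed_segment_def)
    have nx: "n \<bullet> x = n \<bullet> z" unfolding t(3) by (simp add: inner_add_right y(2) left_diff_distrib)
    have le: "N x \<le> 1"
      using N0(4)[of "(1 - t) *\<^sub>R y" "t *\<^sub>R z"] t y z by (simp add: N0(3))
    have "x \<noteq> 0" using nx n(2) by auto
    then have pos: "N x > 0" using N0(1,2)[of x] by (simp add: less_le)
    then have "N ((1 / N x) *\<^sub>R x) \<le> 1" by (simp add: N0(3))
    then have "n \<bullet> z / N x \<le> n \<bullet> z" using n(1) nx by fastforce
    then have "N x \<ge> 1" using pos n(2) by (simp add: field_simps)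
    then show "x \<in> unit_sphere N" using le by (simp add: unit_sphere_def)
  qed
  then show False using N(2) \<open>y \<noteq> z\<close> by (auto simp: no_segment_def)
qed

section \<open>Immersed surfaces\<close>

lemma compact_space_attains_max:
  fixes g :: "'a \<Rightarrow> real"
  assumes "compact_space M" "topspace M \<noteq> {}" "continuous_map M euclideanreal g"
  obtains p where "p \<in> topspace M" "\<And>q. q \<in> topspace M \<Longrightarrow> g q \<le> g p"
proof -
  have "compactin euclideanreal (g ` topspace M)"
    using assms(1) image_compactin[OF _ assms(3)] by (simp add: compact_space_def)
  then have "compact (g ` topspace M)" by simp
  then show ?thesis using compact_attains_sup[of "g ` topspace M"] assms(2) that by auto
qed

locale birkhoff_surface =
  fixes N :: "real^3 \<Rightarrow> real" and M :: "'m topology" and \<A> :: "'m atlas" and f \<eta> :: "'m \<Rightarrow> real^3"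
  assumes norm_N: "admissible_norm N" and surface: "smooth_surface M \<A>"
    and immersion: "smooth_immersion \<A> f" and normal_field: "birkhoff_normal_field N \<A> f \<eta>"
begin

lemma chart: "(V, X) \<in> \<A> \<Longrightarrow> birkhoff_chart N V (f \<circ> X) (\<eta> \<circ> X)"
  using norm_N surface immersion normal_field
  unfolding birkhoff_chart_def smooth_surface_def smooth_immersion_def birkhoff_normal_field_def
    smooth_map_def tangent_plane_def
  by fastforce

lemma chart_homeomorphic:
  "(V, X) \<in> \<A> \<Longrightarrow> homeomorphic_map (top_of_set V) (subtopology M (X ` V)) X"
  using surface unfolding smooth_surface_def by blast

lemma chart_inj_on: "(V, X) \<in> \<A> \<Longrightarrow> inj_on X V"
  using chart_homeomorphic homeomorphic_imp_injective_map by fastforce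

lemma chart_openin: "(V, X) \<in> \<A> \<Longrightarrow> openin M (X ` V)"
  using surface unfolding smooth_surface_def by blast

lemma chart_open: "(V, X) \<in> \<A> \<Longrightarrow> open V"
  using surface unfolding smooth_surface_def by blast

lemma chart_topspace: "(V, X) \<in> \<A> \<Longrightarrow> u \<in> V \<Longrightarrow> X u \<in> topspace M"
  using chart_openin openin_subset by blast

lemma chart_cover:
  assumes "p \<in> topspace M"
  obtains V X u where "(V, X) \<in> \<A>" "u \<in> V" "X u = p"
proof -
  have "topspace M = (\<Union>(V, X)\<in>\<A>. X ` V)" using surface unfolding smooth_surface_def by blast
  then show ?thesis using assms that by fastforce
qed

lemma chart_open_image:
  assumes c: "(V, X) \<in> \<A>" and U: "open U" "U \<subseteq> V"
  shows "openin M (X ` U)"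
proof -
  have "openin (top_of_set V) U" using U by (simp add: open_subset)
  then have "openin (subtopology M (X ` V)) (X ` U)"
    using homeomorphic_imp_open_map[OF chart_homeomorphic[OF c]] by (simp add: open_map_def)
  then show ?thesis using chart_openin[OF c] openin_trans_full by blast
qed

lemma chart_open_vimage:
  assumes c: "(V, X) \<in> \<A>" and U: "openin M U"
  shows "open {u \<in> V. X u \<in> U}"
proof -
  have "continuous_map (top_of_set V) (subtopology M (X ` V)) X"
    using chart_homeomorphic[OF c] homeomorphic_imp_continuous_map by blast
  then have "continuous_map (top_of_set V) M X"
    using continuous_map_into_fulltopology by blast
  then have "openin (top_of_set V) {u \<in> topspace (top_of_set V). X u \<in> U}"
    using U by (rule openin_continuous_map_preimage)
  then show ?thesis using chart_open[OF c] openin_open_trans by fastforce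
qed

lemma change_of_chart_smooth:
  assumes "(V, X) \<in> \<A>" "(V', X') \<in> \<A>"
  shows "smooth_on {u \<in> V. X u \<in> X' ` V'} (\<lambda>u. inv_into V' X' (X u))"
proof -
  have "\<forall>(V, X)\<in>\<A>. \<forall>(V', X')\<in>\<A>. smooth_on {u \<in> V. X u \<in> X' ` V'} (\<lambda>u. inv_into V' X' (X u))"
    using surface unfolding smooth_surface_def by (elim conjE)
  from bspec[OF this assms(1)]
  have "\<forall>(V', X')\<in>\<A>. smooth_on {u \<in> V. X u \<in> X' ` V'} (\<lambda>u. inv_into V' X' (X u))"
    unfolding prod.case .
  from bspec[OF this assms(2)] show ?thesis unfolding prod.case .
qed

lemma continuous_map_charts:
  fixes g :: "'m \<Rightarrow> 'c::topological_space"
  assumes "\<And>V X. (V, X) \<in> \<A> \<Longrightarrow> continuous_on V (g \<circ> X)"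
  shows "continuous_map M euclidean g"
  unfolding continuous_map_def
proof (intro conjI allI impI)
  fix U :: "'c set" assume "openin euclidean U"
  then have U: "open U" by simp
  show "openin M {x \<in> topspace M. g x \<in> U}"
  proof (subst openin_subopen, intro ballI)
    fix p assume p: "p \<in> {x \<in> topspace M. g x \<in> U}"
    then obtain V X u where c: "(V, X) \<in> \<A>" "u \<in> V" "X u = p" using chart_cover by blast
    have "open (V \<inter> (g \<circ> X) -` U)"
      by (rule continuous_open_preimage[OF assms[OF c(1)] chart_open[OF c(1)] U])
    then have "openin M (X ` (V \<inter> (g \<circ> X) -` U))"
      by (intro chart_open_image[OF c(1)]) auto
    moreover have "X ` (V \<inter> (g \<circ> X) -` U) \<subseteq> {x \<in> topspace M. g x \<in> U}"
      using chart_topspace[OF c(1)] by auto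
    moreover have "p \<in> X ` (V \<inter> (g \<circ> X) -` U)" using c p by auto
    ultimately show "\<exists>T. openin M T \<and> p \<in> T \<and> T \<subseteq> {x \<in> topspace M. g x \<in> U}" by blast
  qed
qed simp

text \<open>The principal values at a point are collected over all charts around it. The derivative of a
  change of charts transports eigenvectors, so any single chart gives all of them.\<close>

lemma eigenvector_change_of_chart:
  assumes c: "(V, X) \<in> \<A>" "u \<in> V" and c': "(V', X') \<in> \<A>" "u' \<in> V'" and eq: "X u = X' u'"
    and w: "w \<noteq> 0" "dder (\<eta> \<circ> X) u w = l *\<^sub>R dder (f \<circ> X) u w"
  shows "\<exists>w'. w' \<noteq> 0 \<and> dder (\<eta> \<circ> X') u' w' = l *\<^sub>R dder (f \<circ> X') u' w'"
proof -
  interpret C: birkhoff_chart N V "f \<circ> X" "\<eta> \<circ> X" by (rule chart[OF c(1)])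
  interpret C': birkhoff_chart N V' "f \<circ> X'" "\<eta> \<circ> X'" by (rule chart[OF c'(1)])
  define \<tau> where "\<tau> x = inv_into V' X' (X x)" for x
  define D where "D = {x \<in> V. X x \<in> X' ` V'}"
  have D: "open D" "u \<in> D"
    unfolding D_def using chart_open_vimage[OF c(1) chart_openin[OF c'(1)]] c(2) c'(2) eq by auto
  have s\<tau>: "smooth_on D \<tau>"
    unfolding D_def \<tau>_def by (rule change_of_chart_smooth[OF c(1) c'(1)])
  have \<tau>: "X' (\<tau> x) = X x" if "x \<in> D" for x
    using that unfolding \<tau>_def D_def by (simp add: f_inv_into_f)
  have \<tau>u: "\<tau> u = u'" unfolding \<tau>_def eq by (rule inv_into_f_f[OF chart_inj_on[OF c'(1)] c'(2)])
  have chain: "dder (g \<circ> X) u w = dder (g \<circ> X') u' (dder \<tau> u w)"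
    if "smooth_on V' (g \<circ> X')" for g :: "'m \<Rightarrow> real^3"
  proof (rule dder_eqI)
    have "((\<lambda>x. (g \<circ> X') (\<tau> x)) has_derivative (\<lambda>w. dder (g \<circ> X') u' (dder \<tau> u w))) (at u)"
      by (rule has_derivative_compose[OF smooth_on_has_derivative[OF s\<tau> D(2)]])
        (unfold \<tau>u, rule smooth_on_has_derivative[OF that c'(2)])
    then show "((g \<circ> X) has_derivative (\<lambda>w. dder (g \<circ> X') u' (dder \<tau> u w))) (at u)"
      by (rule has_derivative_cong_open[OF D, rotated]) (simp add: \<tau>)
  qed
  have "dder \<tau> u w \<noteq> 0"
  proof
    assume "dder \<tau> u w = 0"
    then have "dder (f \<circ> X) u w = dder (f \<circ> X) u 0"
      using chain[OF C'.smooth_F] linear_0[OF C'.linear_dF[OF c'(2)]] linear_0[OF C.linear_dF[OF c(2)]] by simp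
    then show False using C.inj_dF[OF c(2)] w(1) by (auto dest: injD)
  qed
  then show ?thesis using w(2) chain[OF C'.smooth_F] chain[OF C'.smooth_E] by auto
qed

lemma principal_values_chart:
  assumes c: "(V, X) \<in> \<A>" "u \<in> V"
  shows "principal_values \<A> f \<eta> (X u) = {l. \<exists>w. w \<noteq> 0 \<and> dder (\<eta> \<circ> X) u w = l *\<^sub>R dder (f \<circ> X) u w}"
proof (intro set_eqI iffI)
  fix l assume "l \<in> principal_values \<A> f \<eta> (X u)"
  then obtain V' X' u' w where "(V', X') \<in> \<A>" "u' \<in> V'" "X' u' = X u" "w \<noteq> 0"
      "dder (\<eta> \<circ> X') u' w = l *\<^sub>R dder (f \<circ> X') u' w"
    unfolding principal_values_def principal_vector_def by blast
  from eigenvector_change_of_chart[OF this(1,2) c this(3-5)]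
  show "l \<in> {l. \<exists>w. w \<noteq> 0 \<and> dder (\<eta> \<circ> X) u w = l *\<^sub>R dder (f \<circ> X) u w}" by simp
next
  fix l assume "l \<in> {l. \<exists>w. w \<noteq> 0 \<and> dder (\<eta> \<circ> X) u w = l *\<^sub>R dder (f \<circ> X) u w}"
  then show "l \<in> principal_values \<A> f \<eta> (X u)"
    unfolding principal_values_def principal_vector_def using c by blast
qed

lemma lambda_chart:
  assumes c: "(V, X) \<in> \<A>" "u \<in> V"
  defines "t \<equiv> birkhoff_chart.a11 (f \<circ> X) (\<eta> \<circ> X) u + birkhoff_chart.a22 (f \<circ> X) (\<eta> \<circ> X) u"
    and "d \<equiv> birkhoff_chart.disc (f \<circ> X) (\<eta> \<circ> X) u"
  shows "lambda1 \<A> f \<eta> (X u) = (t + sqrt d) / 2" "lambda2 \<A> f \<eta> (X u) = (t - sqrt d) / 2"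
  using birkhoff_chart.max_min_eigenvalue[OF chart[OF c(1)] c(2) refl]
  unfolding lambda1_def lambda2_def principal_values_chart[OF c] t_def d_def by simp_all

lemma lambda_le:
  assumes "p \<in> topspace M"
  shows "lambda2 \<A> f \<eta> p \<le> lambda1 \<A> f \<eta> p"
proof -
  obtain V X u where c: "(V, X) \<in> \<A>" "u \<in> V" "X u = p" using chart_cover assms by blast
  show ?thesis
    using real_sqrt_ge_zero[OF birkhoff_chart.disc_nonneg[OF chart[OF c(1)] c(2)]]
    unfolding c(3)[symmetric] lambda_chart[OF c(1,2)] by simp
qed

lemma continuous_lambda1: "continuous_map M euclideanreal (lambda1 \<A> f \<eta>)"
proof (rule continuous_map_charts)
  fix V X assume c: "(V, X) \<in> \<A>"
  interpret C: birkhoff_chart N V "f \<circ> X" "\<eta> \<circ> X" by (rule chart[OF c])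
  have "continuous_on V (\<lambda>u. (C.a11 u + C.a22 u + sqrt (C.disc u)) / 2)"
    by (intro continuous_intros C.continuous_disc smooth_on_imp_continuous_on C.smooth_coefficients) auto
  then show "continuous_on V (lambda1 \<A> f \<eta> \<circ> X)"
    by (rule continuous_on_eq) (simp add: lambda_chart[OF c])
qed

lemma umbilic_dE:
  assumes c: "(V, X) \<in> \<A>" "u \<in> V" and um: "umbilic \<A> f \<eta> (X u)"
  shows "dder (\<eta> \<circ> X) u w = lambda1 \<A> f \<eta> (X u) *\<^sub>R dder (f \<circ> X) u w"
proof -
  interpret C: birkhoff_chart N V "f \<circ> X" "\<eta> \<circ> X" by (rule chart[OF c(1)])
  have d: "C.disc u = 0"
    using um lambda_chart[OF c] C.disc_nonneg[OF c(2)] unfolding umbilic_def by simp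
  obtain w0 where "principal_vector f \<eta> X u (lambda1 \<A> f \<eta> (X u)) w0"
  proof -
    have "lambda1 \<A> f \<eta> (X u) \<in> {l. \<exists>w. w \<noteq> 0 \<and> dder (\<eta> \<circ> X) u w = l *\<^sub>R dder (f \<circ> X) u w}"
      unfolding C.eigenvalues[OF c(2)] lambda_chart[OF c] by simp
    then show ?thesis using that unfolding principal_vector_def by blast
  qed
  then have w0: "w0 \<noteq> 0" "lambda1 \<A> f \<eta> (X u) *\<^sub>R dder (f \<circ> X) u w0 = C.a11 u *\<^sub>R dder (f \<circ> X) u w0"
    using C.disc_zero_scalar[OF c(2) d, of w0] by (auto simp: principal_vector_def)
  have "dder (f \<circ> X) u w0 \<noteq> 0"
    using w0(1) C.inj_dF[OF c(2)] linear_0[OF C.linear_dF[OF c(2)]] by (metis injD)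
  then show ?thesis using w0(2) C.disc_zero_scalar[OF c(2) d, of w] by simp
qed

lemma zero_derivative_imp_constant:
  fixes g :: "'m \<Rightarrow> 'c::real_normed_vector"
  assumes con: "connected_space M"
    and D: "\<And>V X u. (V, X) \<in> \<A> \<Longrightarrow> u \<in> V \<Longrightarrow> ((g \<circ> X) has_derivative (\<lambda>w. 0)) (at u)"
  shows "\<exists>c. \<forall>p\<in>topspace M. g p = c"
proof -
  have loc: "\<exists>T. openin M T \<and> p \<in> T \<and> (\<forall>q\<in>T. g q = g p)" if p: "p \<in> topspace M" for p
  proof -
    obtain V X u where c: "(V, X) \<in> \<A>" "u \<in> V" "X u = p" using chart_cover p by blast
    obtain r where r: "r > 0" "ball u r \<subseteq> V" using chart_open[OF c(1)] c(2) openE by blast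
    have "\<exists>k. \<forall>x\<in>ball u r. (g \<circ> X) x = k"
      by (rule has_derivative_zero_constant[OF convex_ball has_derivative_at_withinI[OF D[OF c(1)]]])
        (use r in auto)
    then have "\<forall>x\<in>ball u r. g (X x) = g p" using r(1) c(3) by (metis centre_in_ball comp_apply)
    moreover have "openin M (X ` ball u r)" using chart_open_image[OF c(1) open_ball r(2)] .
    moreover have "p \<in> X ` ball u r" using r(1) c(3) by auto
    ultimately show ?thesis by blast
  qed
  show ?thesis
  proof (cases "topspace M = {}")
    case False
    then obtain p where p: "p \<in> topspace M" by blast
    let ?T = "{q \<in> topspace M. g q = g p}"
    have op: "openin M {q \<in> topspace M. P (g q)}" for P
    proof (subst openin_subopen, intro ballI)
      fix q assume q: "q \<in> {q \<in> topspace M. P (g q)}"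
      then obtain T where T: "openin M T" "q \<in> T" "\<forall>r\<in>T. g r = g q" using loc by blast
      have "T \<subseteq> {q \<in> topspace M. P (g q)}"
        using openin_subset[OF T(1)] T(3) q by auto
      then show "\<exists>T. openin M T \<and> q \<in> T \<and> T \<subseteq> {q \<in> topspace M. P (g q)}"
        using T by blast
    qed
    have "openin M ?T" "openin M {q \<in> topspace M. g q \<noteq> g p}"
      using op[of "\<lambda>y. y = g p"] op[of "\<lambda>y. y \<noteq> g p"] by simp_all
    moreover have "topspace M - ?T = {q \<in> topspace M. g q \<noteq> g p}" by blast
    ultimately have "openin M ?T" "closedin M ?T" by (simp_all add: closedin_def)
    then have "?T = {} \<or> ?T = topspace M" using con unfolding connected_space_clopen_in by blast
    then show ?thesis using p by blast
  qed auto
qed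

section \<open>Totally umbilic surfaces\<close>

lemma continuous_normal: "continuous_map M euclidean \<eta>"
  by (rule continuous_map_charts)
    (rule smooth_on_imp_continuous_on[OF birkhoff_chart.smooth_E[OF chart]])

text \<open>At an extremum of \<open>n \<bullet> \<eta>\<close> the relation \<open>d\<eta> = h df\<close> makes \<open>n\<close> a conormal of the tangent plane. The plane
  through \<open>\<eta>\<close> that supports the ball is then a level set of \<open>n\<close>, and so one of the two support planes
  \<open>n \<bullet> x = \<plusminus> n \<bullet> z\<close>.\<close>

lemma critical_point_value:
  assumes h: "h \<noteq> 0" and c: "(V, X) \<in> \<A>" "u \<in> V"
    and dE: "\<And>w. dder (\<eta> \<circ> X) u w = h *\<^sub>R dder (f \<circ> X) u w"
    and n: "\<And>x. N x \<le> 1 \<Longrightarrow> n \<bullet> x \<le> n \<bullet> z" "n \<noteq> 0" and z: "N z = 1"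
    and ext: "(\<forall>q\<in>topspace M. n \<bullet> \<eta> q \<le> n \<bullet> \<eta> (X u)) \<or> (\<forall>q\<in>topspace M. n \<bullet> \<eta> (X u) \<le> n \<bullet> \<eta> q)"
  shows "n \<bullet> \<eta> (X u) = n \<bullet> z \<or> n \<bullet> \<eta> (X u) = - (n \<bullet> z)"
proof -
  interpret C: birkhoff_chart N V "f \<circ> X" "\<eta> \<circ> X" by (rule chart[OF c(1)])
  have Neg: "N (- x) = N x" for x
    using norm_N unfolding admissible_norm_def is_norm_def by (metis abs_minus_cancel abs_one mult_1 scaleR_minus1_left)
  have "((\<lambda>v. n \<bullet> (\<eta> \<circ> X) v) has_derivative (\<lambda>w. n \<bullet> dder (\<eta> \<circ> X) u w)) (at u)"
    by (intro has_derivative_inner_right smooth_on_has_derivative[OF C.smooth_E c(2)])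
  then have *: "(\<lambda>w. n \<bullet> dder (\<eta> \<circ> X) u w) = (\<lambda>v. 0)"
    using ext chart_topspace[OF c(1)] by (intro differential_zero_maxmin[OF c(2) C.open_V]) auto
  then have perp: "dder (f \<circ> X) u w \<bullet> n = 0" for w
    using fun_cong[OF *, of w] h by (simp add: dE inner_commute)
  obtain n' where n': "n' \<noteq> 0" "\<And>w. dder (f \<circ> X) u w \<bullet> n' = 0"
      "\<And>x. N x \<le> 1 \<Longrightarrow> n' \<bullet> x \<le> n' \<bullet> (\<eta> \<circ> X) u"
    using C.supporting_functional[OF c(2)] by blast
  obtain t t' where t: "C.normal_vec u = t *\<^sub>R n" "C.normal_vec u = t' *\<^sub>R n'"
    using cross3_parallel[OF n(2) perp perp] cross3_parallel[OF n'(1) n'(2) n'(2)]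
    unfolding C.normal_vec_def by blast
  then have "t \<noteq> 0" "t' \<noteq> 0" using C.normal_vec_nonzero[OF c(2)] by auto
  then have "(1 / t') *\<^sub>R (t' *\<^sub>R n') = (t / t') *\<^sub>R n" "t / t' \<noteq> 0"
    unfolding t(2)[symmetric] unfolding t(1) by simp_all
  then obtain s where s: "n' = s *\<^sub>R n" "s \<noteq> 0" using \<open>t' \<noteq> 0\<close> that[of "t / t'"] by simp
  have E1: "N (\<eta> (X u)) = 1" using C.E_sphere[OF c(2)] by (simp add: unit_sphere_def)
  have le: "s * (n \<bullet> x) \<le> s * (n \<bullet> \<eta> (X u))" if "N x \<le> 1" for x
    using n'(3)[OF that] s by simp
  show ?thesis
  proof (cases "s > 0")
    case True
    then have "n \<bullet> z \<le> n \<bullet> \<eta> (X u)" using le[of z] z by simp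
    then show ?thesis using n(1)[of "\<eta> (X u)"] E1 by simp
  next
    case False
    then have neg: "s < 0" using s(2) by simp
    have "n \<bullet> \<eta> (X u) \<le> n \<bullet> (- z)"
      by (rule mult_le_cancel_left_neg[OF neg, THEN iffD1, OF le]) (simp add: Neg z)
    moreover have "n \<bullet> (- \<eta> (X u)) \<le> n \<bullet> z" using n(1)[of "- \<eta> (X u)"] E1 by (simp add: Neg)
    ultimately show ?thesis by simp
  qed
qed

text \<open>Maximize \<open>n \<bullet> \<eta>\<close> for a functional \<open>n\<close> that supports the ball at \<open>z\<close>. A maximum with the value \<open>n \<bullet> z\<close>
  is attained at a preimage of \<open>z\<close>. The only other critical value, \<open>- n \<bullet> z\<close>, is the minimum over the
  ball, so it would force \<open>\<eta> = - z\<close> everywhere, although \<open>d\<eta> = h df\<close> is injective.\<close>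

lemma normal_surjective:
  assumes comp: "compact_space M" "topspace M \<noteq> {}" and h: "h \<noteq> 0"
    and dE: "\<And>V X u w. (V, X) \<in> \<A> \<Longrightarrow> u \<in> V \<Longrightarrow> dder (\<eta> \<circ> X) u w = h *\<^sub>R dder (f \<circ> X) u w"
    and z: "N z = 1"
  shows "\<exists>p\<in>topspace M. \<eta> p = z"
proof -
  have N: "is_norm N" "no_segment (unit_sphere N)" using norm_N by (auto simp: admissible_norm_def)
  have Neg: "N (- x) = N x" for x
    using N(1) unfolding is_norm_def by (metis abs_minus_cancel abs_one mult_1 scaleR_minus1_left)
  have N\<eta>: "N (\<eta> p) = 1" if "p \<in> topspace M" for p
    using chart_cover[OF that] birkhoff_chart.E_sphere[OF chart] unfolding unit_sphere_def by fastforce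
  obtain n where n: "n \<noteq> 0" "\<And>x. N x \<le> 1 \<Longrightarrow> n \<bullet> x \<le> n \<bullet> z" "n \<bullet> z > 0"
    using norm_support_functional[OF N(1) z] by blast
  have "continuous_map M euclideanreal (\<lambda>p. n \<bullet> \<eta> p)"
    using continuous_map_compose[OF continuous_normal, of euclideanreal "\<lambda>x. n \<bullet> x"]
    by (simp add: o_def continuous_intros)
  then obtain p where p: "p \<in> topspace M" "\<And>q. q \<in> topspace M \<Longrightarrow> n \<bullet> \<eta> q \<le> n \<bullet> \<eta> p"
    using compact_space_attains_max[OF comp] by blast
  obtain V X u where c: "(V, X) \<in> \<A>" "u \<in> V" "X u = p" using chart_cover p(1) by blast
  have "n \<bullet> \<eta> p = n \<bullet> z \<or> n \<bullet> \<eta> p = - (n \<bullet> z)"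
    using critical_point_value[OF h c(1,2) dE[OF c(1,2)] n(2) n(1) z] p(2) c(3) by auto
  then show ?thesis
  proof
    assume "n \<bullet> \<eta> p = n \<bullet> z"
    then show ?thesis using support_point_unique[OF N n(2,3) z N\<eta>[OF p(1)]] p(1) by blast
  next
    assume neg: "n \<bullet> \<eta> p = - (n \<bullet> z)"
    have const: "\<eta> q = - z" if q: "q \<in> topspace M" for q
    proof -
      have "n \<bullet> (- \<eta> q) \<le> n \<bullet> z" using n(2)[of "- \<eta> q"] N\<eta>[OF q] by (simp add: Neg)
      then have "n \<bullet> (- \<eta> q) = n \<bullet> z" using p(2)[OF q] neg by simp
      then have "- \<eta> q = z" using support_point_unique[OF N n(2,3) z, of "- \<eta> q"] N\<eta>[OF q] by (simp add: Neg)
      then show ?thesis by auto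
    qed
    interpret C: birkhoff_chart N V "f \<circ> X" "\<eta> \<circ> X" by (rule chart[OF c(1)])
    have "dder (\<eta> \<circ> X) u w = 0" for w
    proof (rule dder_eqI)
      show "((\<eta> \<circ> X) has_derivative (\<lambda>w. 0)) (at u)"
        by (rule has_derivative_cong_open[OF C.open_V c(2) _ has_derivative_const[of "- z"]])
          (simp add: const chart_topspace[OF c(1)])
    qed
    then have "dder (f \<circ> X) u (axis 1 1) = dder (f \<circ> X) u 0"
      using dE[OF c(1,2)] h by (metis scaleR_eq_0_iff)
    then have "(axis 1 1 :: real^2) = 0" using C.inj_dF[OF c(2)] by (auto dest: injD)
    then show ?thesis by (simp add: axis_eq_0_iff)
  qed
qed

text \<open>The difference \<open>\<eta> - h f\<close> has derivative zero, so \<open>f\<close> is the image of \<open>\<eta>\<close> under a homothety, and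
  \<open>\<eta>\<close> covers the unit sphere.\<close>

lemma umbilic_imp_minkowski_sphere:
  assumes M: "compact_space M" "topspace M \<noteq> {}" "connected_space M" and h: "h \<noteq> 0"
    and dE: "\<And>V X u w. (V, X) \<in> \<A> \<Longrightarrow> u \<in> V \<Longrightarrow> dder (\<eta> \<circ> X) u w = h *\<^sub>R dder (f \<circ> X) u w"
  shows "minkowski_sphere N (f ` topspace M)"
proof -
  have "\<exists>c. \<forall>p\<in>topspace M. \<eta> p - h *\<^sub>R f p = c"
  proof (rule zero_derivative_imp_constant[OF M(3)])
    fix V X u assume c: "(V, X) \<in> \<A>" "u \<in> V"
    interpret C: birkhoff_chart N V "f \<circ> X" "\<eta> \<circ> X" by (rule chart[OF c(1)])
    have "((\<lambda>u. (\<eta> \<circ> X) u - h *\<^sub>R (f \<circ> X) u) has_derivative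
        (\<lambda>w. dder (\<eta> \<circ> X) u w - h *\<^sub>R dder (f \<circ> X) u w)) (at u)"
      by (intro has_derivative_diff has_derivative_scaleR_right smooth_on_has_derivative[OF C.smooth_E c(2)]
          smooth_on_has_derivative[OF C.smooth_F c(2)])
    then show "((\<lambda>p. \<eta> p - h *\<^sub>R f p) \<circ> X has_derivative (\<lambda>w. 0)) (at u)"
      using dE[OF c] by (simp add: o_def)
  qed
  then obtain c where c: "\<And>p. p \<in> topspace M \<Longrightarrow> \<eta> p - h *\<^sub>R f p = c" by blast
  have N0: "N (a *\<^sub>R x) = \<bar>a\<bar> * N x" for a x
    using norm_N unfolding admissible_norm_def is_norm_def by blast
  have N\<eta>: "N (\<eta> p) = 1" if "p \<in> topspace M" for p
    using chart_cover[OF that] birkhoff_chart.E_sphere[OF chart] unfolding unit_sphere_def by fastforce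
  have aff: "h *\<^sub>R (x - (- (1 / h) *\<^sub>R c)) = h *\<^sub>R x + c" for x
    using h by (simp add: scaleR_add_right)
  have iff: "N (x - (- (1 / h) *\<^sub>R c)) = 1 / \<bar>h\<bar> \<longleftrightarrow> N (h *\<^sub>R x + c) = 1" for x
    unfolding aff[symmetric] N0 using h by (simp add: field_simps)
  have "f ` topspace M = {x. N (x - (- (1 / h) *\<^sub>R c)) = 1 / \<bar>h\<bar>}"
    unfolding iff
  proof (intro set_eqI iffI)
    fix x assume "x \<in> f ` topspace M"
    then obtain p where p: "p \<in> topspace M" "x = f p" by blast
    then have "h *\<^sub>R x + c = \<eta> p" using c by (metis diff_add_cancel add.commute)
    then show "x \<in> {x. N (h *\<^sub>R x + c) = 1}" using N\<eta>[OF p(1)] by simp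
  next
    fix x assume "x \<in> {x. N (h *\<^sub>R x + c) = 1}"
    then have "\<exists>p\<in>topspace M. \<eta> p = h *\<^sub>R x + c"
      by (intro normal_surjective[OF M(1,2) h]) (auto intro: dE)
    then obtain p where p: "p \<in> topspace M" "\<eta> p = h *\<^sub>R x + c" by blast
    then have "h *\<^sub>R x = h *\<^sub>R f p" using c[OF p(1)] by (simp add: algebra_simps)
    then show "x \<in> f ` topspace M" using h p(1) by simp
  qed
  then show ?thesis using h unfolding minkowski_sphere_def by (metis zero_less_abs_iff zero_less_divide_1_iff)
qed

section \<open>The maximum of the greatest principal curvature\<close>

text \<open>At a non-umbilic maximum the Codazzi equation yields \<open>f1 = - w2(l1) / (l1 - l2)\<close>, whose derivative
  along \<open>w2\<close> is non-negative by the second derivative test.\<close>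

lemma max_lambda1_umbilic:
  assumes p: "p \<in> topspace M" and mx: "\<And>q. q \<in> topspace M \<Longrightarrow> lambda1 \<A> f \<eta> q \<le> lambda1 \<A> f \<eta> p"
    and mean: "\<And>q. q \<in> topspace M \<Longrightarrow> minkowski_mean_curvature \<A> f \<eta> q = h"
    and coercive: "coercively_convex_at \<A> f \<eta> p"
  shows "umbilic \<A> f \<eta> p"
proof (rule ccontr)
  assume "\<not> umbilic \<A> f \<eta> p"
  from mp[OF coercive[unfolded coercively_convex_at_def] this]
  obtain V X W u w1 w2 where c: "(V, X) \<in> \<A>" and W: "open W" "W \<subseteq> V" "u \<in> W" "X u = p"
    and nu: "\<forall>x\<in>W. \<not> umbilic \<A> f \<eta> (X x)"
    and cpf: "commuting_principal_fields \<A> f \<eta> X W w1 w2"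
    and coer: "\<forall>f1 g1. smooth_on W f1 \<and> smooth_on W g1 \<and>
             (\<forall>x\<in>W. flat_deriv f X w1 w2 x = f1 x *\<^sub>R push f X w1 x + g1 x *\<^sub>R push f X w2 x) \<longrightarrow>
             flat_deriv f X w1 w2 u = 0 \<longrightarrow> dder f1 u (w2 u) < (0::real)"
    by (elim bexE) (simp only: split_paired_all prod.case, elim exE conjE, rule that)
  interpret C: birkhoff_chart N V "f \<circ> X" "\<eta> \<circ> X" by (rule chart[OF c])
  define l1 l2 where "l1 = (\<lambda>x. lambda1 \<A> f \<eta> (X x))" and "l2 = (\<lambda>x. lambda2 \<A> f \<eta> (X x))"
  have top: "X x \<in> topspace M" if "x \<in> W" for x using chart_topspace[OF c] W(2) that by blast
  have gap: "l1 x - l2 x > 0" if "x \<in> W" for x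
    using lambda_le[OF top[OF that]] bspec[OF nu that] unfolding l1_def l2_def umbilic_def by simp
  have l2: "l2 x = 2 * h - l1 x" if "x \<in> W" for x
    using mean[OF top[OF that]] unfolding l1_def l2_def minkowski_mean_curvature_def by (simp add: field_simps)
  have w: "smooth_on W w1" "smooth_on W w2" "\<And>x. x \<in> W \<Longrightarrow> lie_bracket w1 w2 x = 0" "\<And>x. x \<in> W \<Longrightarrow> w1 x \<noteq> 0"
    and eig: "\<And>x. x \<in> W \<Longrightarrow> dder (\<eta> \<circ> X) x (w1 x) = l1 x *\<^sub>R dder (f \<circ> X) x (w1 x)"
      "\<And>x. x \<in> W \<Longrightarrow> dder (\<eta> \<circ> X) x (w2 x) = l2 x *\<^sub>R dder (f \<circ> X) x (w2 x)"
    using cpf unfolding commuting_principal_fields_def principal_vector_def l1_def l2_def by auto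
  have F: "smooth_on W (f \<circ> X)" and E: "smooth_on W (\<eta> \<circ> X)"
    using smooth_on_subset[OF C.smooth_F W(2)] smooth_on_subset[OF C.smooth_E W(2)] by auto
  let ?P1 = "\<lambda>x. dder (f \<circ> X) x (w1 x)"
  have P1: "smooth_on W ?P1" by (rule smooth_on_dder_field[OF F w(1) W(1)])
  have P1_nz: "?P1 x \<noteq> 0" if "x \<in> W" for x
    using w(4)[OF that] C.inj_dF linear_0[OF C.linear_dF] W(2) that by (metis injD subsetD)
  \<comment> \<open>The eigenvalue is smooth because its eigenvector field is.\<close>
  have sl1: "smooth_on W l1"
  proof (rule smooth_on_cong)
    show "smooth_on W (\<lambda>x. (dder (\<eta> \<circ> X) x (w1 x) \<bullet> ?P1 x) / (?P1 x \<bullet> ?P1 x))"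
      using P1_nz by (intro smooth_on_divide smooth_on_inner P1 W(1) smooth_on_dder_field[OF E w(1)]) auto
    show "(dder (\<eta> \<circ> X) x (w1 x) \<bullet> ?P1 x) / (?P1 x \<bullet> ?P1 x) = l1 x" if "x \<in> W" for x
      using P1_nz[OF that] eig(1)[OF that] by simp
  qed (rule W(1))
  have sl2: "smooth_on W l2"
    by (rule smooth_on_cong[OF smooth_on_diff[OF smooth_on_const sl1 W(1)] W(1)]) (rule l2[symmetric])
  define k where "k = (\<lambda>x. inverse (l1 x - l2 x))"
  have sk: "smooth_on W k"
    unfolding k_def using gap by (intro smooth_on_inverse smooth_on_diff sl1 sl2 W(1)) (simp add: less_le)
  define G where "G = (\<lambda>x. dder l1 x (w2 x))"
  have sG: "smooth_on W G" unfolding G_def by (rule smooth_on_dder_field[OF sl1 w(2) W(1)])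
  define f1 where "f1 = (\<lambda>x. - (G x * k x))"
  define g1 where "g1 = (\<lambda>x. dder l2 x (w1 x) * k x)"
  have sf1: "smooth_on W f1" unfolding f1_def by (intro smooth_on_minus smooth_on_mult sG sk W(1))
  have sg1: "smooth_on W g1"
    unfolding g1_def by (intro smooth_on_mult sk W(1) smooth_on_dder_field[OF sl2 w(1)])
  have fd: "flat_deriv f X w1 w2 x = f1 x *\<^sub>R push f X w1 x + g1 x *\<^sub>R push f X w2 x" if x: "x \<in> W" for x
  proof -
    have "flat_deriv f X w1 w2 x = dder (\<lambda>y. dder (f \<circ> X) y (w2 y)) x (w1 x)"
      unfolding flat_deriv_def push_def[abs_def] ..
    also have "\<dots> = k x *\<^sub>R ((l1 x - l2 x) *\<^sub>R \<dots>)" using gap[OF x] by (simp add: k_def)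
    also have "(l1 x - l2 x) *\<^sub>R dder (\<lambda>y. dder (f \<circ> X) y (w2 y)) x (w1 x)
        = dder l2 x (w1 x) *\<^sub>R dder (f \<circ> X) x (w2 x) - dder l1 x (w2 x) *\<^sub>R dder (f \<circ> X) x (w1 x)"
      by (rule codazzi_commuting_fields[OF W(1) x F E w(1,2) w(3)[OF x] sl1 sl2 eig])
    also have "k x *\<^sub>R \<dots> = f1 x *\<^sub>R push f X w1 x + g1 x *\<^sub>R push f X w2 x"
      by (simp add: f1_def g1_def G_def push_def algebra_simps)
    finally show ?thesis .
  qed
  have u: "u \<in> W" by (rule W(3))
  have mx': "l1 x \<le> l1 u" if "x \<in> W" for x
    using mx[OF top[OF that]] W(4) by (simp add: l1_def)
  have dl1: "dder l1 u = (\<lambda>v. 0)"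
    using differential_zero_maxmin[OF u W(1) smooth_on_has_derivative[OF sl1 u]] mx' by blast
  have dl2: "dder l2 u v = 0" for v
  proof -
    have "((\<lambda>x. 2 * h - l1 x) has_derivative (\<lambda>v. 0 - dder l1 u v)) (at u)"
      by (intro has_derivative_diff has_derivative_const smooth_on_has_derivative[OF sl1 u])
    then have "(l2 has_derivative (\<lambda>v. 0 - dder l1 u v)) (at u)"
      by (rule has_derivative_cong_open[OF W(1) u, rotated]) (simp add: l2)
    then show ?thesis using dder_eqI dl1 by fastforce
  qed
  have G0: "G u = 0" by (simp add: G_def dl1)
  have "flat_deriv f X w1 w2 u = 0" using fd[OF u] by (simp add: f1_def g1_def G0 dl2)
  then have neg: "dder f1 u (w2 u) < 0" using coer sf1 sg1 fd by blast
  have "dder f1 u (w2 u) = - (G u * dder k u (w2 u) + dder G u (w2 u) * k u)"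
    unfolding f1_def
    by (rule dder_eqI) (intro has_derivative_minus has_derivative_mult smooth_on_has_derivative[OF _ u] sG sk)
  moreover have "dder G u (w2 u) \<le> 0"
    using dder_dder_field[OF sl1 w(2) W(1) u, of "w2 u"] second_derivative_local_max[OF sl1 W(1) u mx']
    unfolding G_def by (simp add: dl1)
  moreover have "k u > 0" using gap[OF u] by (simp add: k_def)
  ultimately have "dder f1 u (w2 u) \<ge> 0"
    using G0 mult_nonpos_nonneg[of "dder G u (w2 u)" "k u"] by simp
  then show False using neg by simp
qed

end

theorem theorem6p2:
  fixes N :: "real^3 \<Rightarrow> real"
    and M :: "'m topology" and \<A> :: "'m atlas"
    and f \<eta> :: "'m \<Rightarrow> real^3"
  assumes "admissible_norm N"
    and "smooth_surface M \<A>" "topspace M \<noteq> {}" "compact_space M" "connected_space M"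
    and "smooth_immersion \<A> f"
    and "birkhoff_normal_field N \<A> f \<eta>"
    and "\<And>p. p \<in> topspace M \<Longrightarrow> (\<forall>q\<in>topspace M. lambda1 \<A> f \<eta> q \<le> lambda1 \<A> f \<eta> p) \<Longrightarrow>
           coercively_convex_at \<A> f \<eta> p"
    and "\<And>p. p \<in> topspace M \<Longrightarrow> minkowski_gauss_curvature \<A> f \<eta> p > 0"
    and "\<exists>h. \<forall>p\<in>topspace M. minkowski_mean_curvature \<A> f \<eta> p = h"
  shows "minkowski_sphere N (f ` topspace M)"
proof -
  interpret birkhoff_surface N M \<A> f \<eta>
    using assms(1,2,6,7) by unfold_locales
  obtain h where h: "\<And>p. p \<in> topspace M \<Longrightarrow> minkowski_mean_curvature \<A> f \<eta> p = h"
    using assms(10) by blast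
  obtain p where p: "p \<in> topspace M" "\<And>q. q \<in> topspace M \<Longrightarrow> lambda1 \<A> f \<eta> q \<le> lambda1 \<A> f \<eta> p"
    using compact_space_attains_max[OF assms(4,3) continuous_lambda1] by blast
  have "umbilic \<A> f \<eta> p"
    using max_lambda1_umbilic[OF p h] assms(8) p by blast
  then have lp: "lambda1 \<A> f \<eta> p = h"
    using h[OF p(1)] by (simp add: umbilic_def minkowski_mean_curvature_def)
  have sum: "lambda1 \<A> f \<eta> q + lambda2 \<A> f \<eta> q = 2 * h" if "q \<in> topspace M" for q
    using h[OF that] by (simp add: minkowski_mean_curvature_def)
  have l1: "lambda1 \<A> f \<eta> q = h" and um: "umbilic \<A> f \<eta> q" if "q \<in> topspace M" for q
    using lambda_le[OF that] p(2)[OF that] sum[OF that] lp by (simp_all add: umbilic_def)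
  show ?thesis
  proof (rule umbilic_imp_minkowski_sphere[OF assms(4,3,5)])
    show "h \<noteq> 0" using assms(9)[OF p(1)] lp by (auto simp: minkowski_gauss_curvature_def)
    show "dder (\<eta> \<circ> X) u w = h *\<^sub>R dder (f \<circ> X) u w" if c: "(V, X) \<in> \<A>" "u \<in> V" for V X u w
      using umbilic_dE[OF c um[OF chart_topspace[OF c]]] l1[OF chart_topspace[OF c]] by simp
  qed
qed

end
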